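(* Let the min-max assumptions in the context hold, let $(\rho_x,\rho_y)\in\mathbb R_{++}^2$ and $(x_0,y_0)\in X\times Y$, and let $(x,u)$ be the pair output by the AIPP.S method (described in the context) with parameter $\xi>0$ and tolerance $\rho$ satisfying $$\xi\ge\frac{D_y}{\rho_y},\qquad\rho=\rho_x .$$ Define $$(\bar u,\bar v)=\left(u,\frac{y_0-y_\xi(x)}\xi\right),\qquad(\bar x,\bar y)=(x,y_\xi(x)).$$ Then: (a) the AIPP.S method performs $$\mathcal O\left(\Omega_\xi\left[\frac{m^2R_{1/(2m)}\hat p(x_0)}{\rho_x^2}+\frac{mD_y^2}{\xi\rho_x^2}+\log_1^+(\Omega_\xi)\right]\right)$$ oracle calls, where $\Omega_\xi=1+\dfrac{\sqrt\xi L_y+\sqrt{L_x}}{\sqrt m}$; (b) the pair $([\bar x,\bar y],[\bar u,\bar v])$ satisfies $$\bar u\in\nabla_x\Phi(\bar x,\bar y)+\partial h(\bar x),\quad\bar v\in\partial[-\Phi(\bar x,\cdot)](\bar y),\quad\|\bar u\|\le\rho_x,\quad\|\bar v\|\le\rho_y .$$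
   Context: Min-max assumptions. $\mathcal X,\mathcal Y$ are finite dimensional inner product spaces; $X\subset\mathcal X$, $Y\subset\mathcal Y$ are nonempty convex sets and $Y$ is compact; there is an open $\Omega\supseteq X$ with $\Phi$ finite and continuous on $\Omega\times Y$, and $\nabla_x\Phi$ exists and is continuous on $\Omega\times Y$; $h\in\overline{\mathrm{Conv}}(X)$ and $-\Phi(x,\cdot)\in\overline{\mathrm{Conv}}(Y)$ for $x\in\Omega$; there are $L_x,L_y>0$ and $m\in(0,L_x]$ such that for all $x,x'\in X$, $y,y'\in Y$: $\Phi(x,y)-[\Phi(x',y)+\langle\nabla_x\Phi(x',y),x-x'\rangle]\ge-\frac m2\|x-x'\|^2$ and $\|\nabla_x\Phi(x,y)-\nabla_x\Phi(x',y')\|\le L_x\|x-x'\|+L_y\|y-y'\|$; with $p(x)=\max_{y\in Y}\Phi(x,y)$ and $\hat p=p+h$, $\hat p_*=\inf_{x\in X}\hat p(x)>-\infty$. Here $\overline{\mathrm{Conv}}(C)$ denotes proper lower semicontinuous convex functions real-valued exactly on $C$ ($+\infty$ outside). Notation. $D_y$ is the diameter of $Y$. $\ell_F(u;z)=F(z)+\langle\nabla F(z),u-z\rangle$. $p_\xi(x)=\max_{y\in Y}\{\Phi(x,y)-\frac1{2\xi}\|y-y_0\|^2\}$ and $y_\xi(x)$ is its unique maximizer. $\log_1^+(t)=\max\{1,\log t\}$. $R_\lambda\psi(x_0)=\inf_u\{\frac12\|x_0-u\|^2+\lambda[\psi(u)-\inf\psi]\}$. $\mathcal O(B)$ means at most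 $C\max\{1,B\}$ for a universal constant $C$. An oracle call is a collection of $\mathcal O(1)$ oracles, each appearing at least once, for: evaluating $\Phi$, $\nabla_x\Phi$, $h$, and solving exactly $\min_{x\in X}\{\lambda h(x)+\frac12\|x-x'\|^2\}$ and $\max_{y\in Y}\{\lambda\Phi(x',y)-\frac12\|y-y'\|^2\}$ for any given $x',y'$ and $\lambda>0$. ACG iterations with inputs $(\psi_s,\psi_n,y_0,\mu,L)$ (here $y_0$ is a generic starting point): $\psi=\psi_s+\psi_n$, $A_0=0$, $\Gamma_0\equiv0$, $x_0=y_0$, and for $k\ge1$: $\tau_{k-1}=(1+\mu A_{k-1})/L$, $a_{k-1}=\frac12(\tau_{k-1}+\sqrt{\tau_{k-1}^2+4\tau_{k-1}A_{k-1}})$, $A_k=A_{k-1}+a_{k-1}$, $\tilde x_{k-1}=\frac{A_{k-1}}{A_k}y_{k-1}+\frac{a_{k-1}}{A_k}x_{k-1}$, $q_k=\ell_{\psi_s}(\cdot;\tilde x_{k-1})+\psi_n+\frac\mu2\|\cdot-\tilde x_{k-1}\|^2$, $y_k=\operatorname{argmin}_y\{\frac1Lq_k(y)+\frac12\|y-\tilde x_{k-1}\|^2\}$, $x_k=x_{k-1}+\frac{a_{k-1}}{1+\mu A_k}[L(y_k-\tilde x_{k-1})+\mu(y_k-x_{k-1})]$, $\gamma_{k-1}=q_k(y_k)+L\langle\tilde x_{k-1}-y_k,\cdot-y_k\rangle+\frac\mu2\|\cdot-y_k\|^2$, $\Gamma_k=\frac{A_{k-1}}{A_k}\Gamma_{k-1}+\frac{a_{k-1}}{A_k}\gamma_{k-1}$,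 $r_k=(x_0-x_k)/A_k$, $\eta_k=\psi(y_k)-\Gamma_k(x_k)-\langle r_k,y_k-x_k\rangle$. ACG1 (with parameter $\sigma$) returns $(y_k,r_k,\eta_k)$ at the first $k$ with $\|r_k\|^2+2\eta_k\le\sigma\|y_0-y_k+r_k\|^2$ and $A_k\ge\max\{8,9/\mu\}$; ACG2, with extra input $\bar\eta$, at the first $k$ with $\|r_k\|^2+2\eta_k\le\sigma\|y_0-y_k+r_k\|^2$ and $\eta_k\le\bar\eta$. AIPP.S method with inputs $(\xi,\rho)$: set $\lambda=1/(2m)$, $\sigma=1/2$, $L_\xi=L_y[\xi L_y+\sqrt{\xi(L_x+m)}]+L_x$, $f=p_\xi$, $M=L_\xi$, $\mu=1-\lambda m$, $L=1+\lambda M$, $\bar\rho=\rho/4$, $\bar\varepsilon=\rho^2/(32[\max\{m,M\}+\lambda^{-1}])$, $z_0=x_0$. For $k=1,2,\dots$: let $(z_k,\tilde v_k,\tilde\varepsilon_k)$ be the output of ACG1 with inputs $(\lambda f+\frac12\|\cdot-z_{k-1}\|^2,\lambda h,z_{k-1},\mu,L)$. If $\|z_{k-1}-z_k+\tilde v_k\|\le\lambda\bar\rho/5$, let $(z,\tilde v,\tilde\varepsilon)$ be the output of ACG2 with the same inputs and $\bar\eta=\lambda\bar\varepsilon$, put $\bar L=\max\{m,M\}+\lambda^{-1}$, $x=\operatorname{argmin}_{x'}\{\ell_f(x';z)+h(x')+\frac{\bar L}2\|x'-z\|^2\}$, $u=\bar L(z-x)+\nabla f(x)-\nabla f(z)$,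 stop and output $(x,u)$.
   Formalization: Added assumption: the two displayed inequalities for Φ hold on a convex set D with X ⊆ D ⊆ Ω containing all extrapolated points x̃ visited by the ACG runs; without it these points may leave Ω, where ∇p_ξ is undefined. *)

theory Defs
  imports "HOL-Analysis.Analysis"
begin

section \<open>Extended-valued convex functions and gradients\<close>

text \<open>
  Proper lower semicontinuous convex functions that are real-valued exactly on \<open>C\<close> and
  \<open>+\<infinity>\<close> elsewhere.
\<close>

definition closed_conv :: "'a::real_normed_vector set \<Rightarrow> ('a \<Rightarrow> ereal) \<Rightarrow> bool" where
  "closed_conv C \<psi> \<longleftrightarrow>
     C \<noteq> {} \<and> (\<forall>x\<in>C. \<bar>\<psi> x\<bar> \<noteq> \<infinity>) \<and> (\<forall>x. x \<notin> C \<longrightarrow> \<psi> x = \<infinity>) \<and>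
     convex_on C (\<lambda>x. real_of_ereal (\<psi> x)) \<and> (\<forall>x. \<psi> x \<le> Liminf (at x) \<psi>)"

definition subdiff :: "('a::real_inner \<Rightarrow> ereal) \<Rightarrow> 'a \<Rightarrow> 'a set" where
  "subdiff \<psi> x = {v. \<forall>u. \<psi> u \<ge> \<psi> x + ereal (v \<bullet> (u - x))}"

definition grad :: "('a::real_inner \<Rightarrow> real) \<Rightarrow> 'a \<Rightarrow> 'a" where
  "grad f x = (THE D. GDERIV f x :> D)"

definition grad_x :: "('a::real_inner \<Rightarrow> 'b \<Rightarrow> real) \<Rightarrow> 'a \<Rightarrow> 'b \<Rightarrow> 'a" where
  "grad_x \<Phi> x y = grad (\<lambda>x'. \<Phi> x' y) x"

text \<open>\<open>lin F z u\<close> is the linearization of \<open>F\<close> at \<open>z\<close>, evaluated at \<open>u\<close>.\<close>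

definition lin :: "('a::real_inner \<Rightarrow> real) \<Rightarrow> 'a \<Rightarrow> 'a \<Rightarrow> real" where
  "lin F z u = F z + grad F z \<bullet> (u - z)"

definition moreau_gap :: "real \<Rightarrow> ('a::real_inner \<Rightarrow> ereal) \<Rightarrow> 'a \<Rightarrow> ereal" where
  "moreau_gap lam \<psi> x0 =
     (INF u. ereal ((norm (x0 - u))\<^sup>2 / 2) + ereal lam * (\<psi> u - (INF v. \<psi> v)))"

section \<open>The min-max problem\<close>

text \<open>
  \<open>\<Phi>\<close> is a real function of which only the values on \<open>\<Omega> \<times> Y\<close> matter; this makes it finite
  there. \<open>neg_ext Y (\<Phi> x)\<close> is \<open>-\<Phi>(x,\<cdot>)\<close> as an extended-valued function.
\<close>

definition neg_ext :: "'b set \<Rightarrow> ('b \<Rightarrow> real) \<Rightarrow> 'b \<Rightarrow> ereal" where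
  "neg_ext Y g y = (if y \<in> Y then ereal (- g y) else \<infinity>)"

definition p_max :: "'b set \<Rightarrow> ('a \<Rightarrow> 'b \<Rightarrow> real) \<Rightarrow> 'a \<Rightarrow> real" where
  "p_max Y \<Phi> x = (SUP y\<in>Y. \<Phi> x y)"

definition p_hat :: "'b set \<Rightarrow> ('a \<Rightarrow> 'b \<Rightarrow> real) \<Rightarrow> ('a \<Rightarrow> ereal) \<Rightarrow> 'a \<Rightarrow> ereal" where
  "p_hat Y \<Phi> h x = ereal (p_max Y \<Phi> x) + h x"

definition curvature_on ::
  "'a::real_inner set \<Rightarrow> 'b::real_inner set \<Rightarrow> ('a \<Rightarrow> 'b \<Rightarrow> real) \<Rightarrow> real \<Rightarrow> real \<Rightarrow> real \<Rightarrow> bool" where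
  "curvature_on S Y \<Phi> m Lx Ly \<longleftrightarrow>
     (\<forall>x\<in>S. \<forall>x'\<in>S. \<forall>y\<in>Y. \<forall>y'\<in>Y.
        \<Phi> x y - (\<Phi> x' y + grad_x \<Phi> x' y \<bullet> (x - x')) \<ge> - (m / 2) * (norm (x - x'))\<^sup>2 \<and>
        norm (grad_x \<Phi> x y - grad_x \<Phi> x' y') \<le> Lx * norm (x - x') + Ly * norm (y - y'))"

locale minmax =
  fixes X :: "'a::euclidean_space set" and Y :: "'b::euclidean_space set" and \<Omega> :: "'a set"
    and \<Phi> :: "'a \<Rightarrow> 'b \<Rightarrow> real" and h :: "'a \<Rightarrow> ereal" and m Lx Ly :: real
  assumes X: "X \<noteq> {}" "convex X"
    and Y: "Y \<noteq> {}" "convex Y" "compact Y"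
    and Omega: "open \<Omega>" "X \<subseteq> \<Omega>"
    and Phi_cont: "continuous_on (\<Omega> \<times> Y) (\<lambda>(x, y). \<Phi> x y)"
    and Phi_diff: "\<And>x y. x \<in> \<Omega> \<Longrightarrow> y \<in> Y \<Longrightarrow> \<exists>D. GDERIV (\<lambda>x'. \<Phi> x' y) x :> D"
    and grad_cont: "continuous_on (\<Omega> \<times> Y) (\<lambda>(x, y). grad_x \<Phi> x y)"
    and h_conv: "closed_conv X h"
    and Phi_conc: "\<And>x. x \<in> \<Omega> \<Longrightarrow> closed_conv Y (neg_ext Y (\<Phi> x))"
    and parameters: "0 < Lx" "0 < Ly" "0 < m" "m \<le> Lx"
    and curvature: "curvature_on X Y \<Phi> m Lx Ly"
    and bounded_below: "(INF x\<in>X. p_hat Y \<Phi> h x) > - \<infinity>"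

section \<open>Accelerated composite gradient iterations\<close>

record 'a acg_state =
  acgA :: real
  acgx :: 'a
  acgy :: 'a
  acgG :: "'a \<Rightarrow> real"

definition acg_step :: "real \<Rightarrow> real \<Rightarrow> real \<Rightarrow> real" where
  "acg_step \<mu> L A = (let \<tau> = (1 + \<mu> * A) / L in (\<tau> + sqrt (\<tau>\<^sup>2 + 4 * \<tau> * A)) / 2)"

definition acg_extrap :: "real \<Rightarrow> real \<Rightarrow> 'a::real_inner acg_state \<Rightarrow> 'a" where
  "acg_extrap \<mu> L s =
     (let A = acgA s; a = acg_step \<mu> L A in (A / (A + a)) *\<^sub>R acgy s + (a / (A + a)) *\<^sub>R acgx s)"

text \<open>
  \<open>q (y')\<close> is finite at the minimizer \<open>y'\<close> whenever \<open>\<psi>n\<close> is proper, which is why its real part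
  may be taken in \<open>\<gamma>\<close>; the same holds for \<open>\<psi>n (y\<^sub>k)\<close> in \<open>acg_eta\<close> below.
\<close>

definition acg_next ::
  "('a::real_inner \<Rightarrow> real) \<Rightarrow> ('a \<Rightarrow> ereal) \<Rightarrow> real \<Rightarrow> real \<Rightarrow> 'a acg_state \<Rightarrow> 'a acg_state" where
  "acg_next \<psi>s \<psi>n \<mu> L s =
     (let A = acgA s; a = acg_step \<mu> L A; A' = A + a;
          xt = acg_extrap \<mu> L s;
          q = (\<lambda>u. ereal (lin \<psi>s xt u) + \<psi>n u + ereal (\<mu> / 2 * (norm (u - xt))\<^sup>2));
          y' = (ARG_MIN (\<lambda>u. ereal (1 / L) * q u + ereal ((norm (u - xt))\<^sup>2 / 2)) u. True);
          x' = acgx s + (a / (1 + \<mu> * A')) *\<^sub>R (L *\<^sub>R (y' - xt) + \<mu> *\<^sub>R (y' - acgx s));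
          \<gamma> = (\<lambda>u. real_of_ereal (q y') + L * ((xt - y') \<bullet> (u - y')) + \<mu> / 2 * (norm (u - y'))\<^sup>2)
      in \<lparr>acgA = A', acgx = x', acgy = y', acgG = (\<lambda>u. A / A' * acgG s u + a / A' * \<gamma> u)\<rparr>)"

primrec acg_iter ::
  "('a::real_inner \<Rightarrow> real) \<Rightarrow> ('a \<Rightarrow> ereal) \<Rightarrow> 'a \<Rightarrow> real \<Rightarrow> real \<Rightarrow> nat \<Rightarrow> 'a acg_state" where
  "acg_iter \<psi>s \<psi>n y0 \<mu> L 0 = \<lparr>acgA = 0, acgx = y0, acgy = y0, acgG = (\<lambda>u. 0)\<rparr>"
| "acg_iter \<psi>s \<psi>n y0 \<mu> L (Suc k) = acg_next \<psi>s \<psi>n \<mu> L (acg_iter \<psi>s \<psi>n y0 \<mu> L k)"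

definition acg_r :: "'a::real_inner \<Rightarrow> 'a acg_state \<Rightarrow> 'a" where
  "acg_r y0 s = (1 / acgA s) *\<^sub>R (y0 - acgx s)"

definition acg_eta ::
  "('a::real_inner \<Rightarrow> real) \<Rightarrow> ('a \<Rightarrow> ereal) \<Rightarrow> 'a \<Rightarrow> 'a acg_state \<Rightarrow> real" where
  "acg_eta \<psi>s \<psi>n y0 s =
     \<psi>s (acgy s) + real_of_ereal (\<psi>n (acgy s)) - acgG s (acgx s) - acg_r y0 s \<bullet> (acgy s - acgx s)"

definition acg_rel_err ::
  "('a::real_inner \<Rightarrow> real) \<Rightarrow> ('a \<Rightarrow> ereal) \<Rightarrow> 'a \<Rightarrow> real \<Rightarrow> 'a acg_state \<Rightarrow> bool" where
  "acg_rel_err \<psi>s \<psi>n y0 \<sigma> s \<longleftrightarrow>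
     (norm (acg_r y0 s))\<^sup>2 + 2 * acg_eta \<psi>s \<psi>n y0 s \<le> \<sigma> * (norm (y0 - acgy s + acg_r y0 s))\<^sup>2"

definition acg1_stop ::
  "('a::real_inner \<Rightarrow> real) \<Rightarrow> ('a \<Rightarrow> ereal) \<Rightarrow> 'a \<Rightarrow> real \<Rightarrow> real \<Rightarrow> real \<Rightarrow> nat \<Rightarrow> bool" where
  "acg1_stop \<psi>s \<psi>n y0 \<mu> L \<sigma> k \<longleftrightarrow>
     (let s = acg_iter \<psi>s \<psi>n y0 \<mu> L k in acg_rel_err \<psi>s \<psi>n y0 \<sigma> s \<and> acgA s \<ge> max 8 (9 / \<mu>))"

definition acg2_stop ::
  "('a::real_inner \<Rightarrow> real) \<Rightarrow> ('a \<Rightarrow> ereal) \<Rightarrow> 'a \<Rightarrow> real \<Rightarrow> real \<Rightarrow> real \<Rightarrow> real \<Rightarrow> nat \<Rightarrow> bool" where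
  "acg2_stop \<psi>s \<psi>n y0 \<mu> L \<sigma> \<eta>bar k \<longleftrightarrow>
     (let s = acg_iter \<psi>s \<psi>n y0 \<mu> L k in
        acg_rel_err \<psi>s \<psi>n y0 \<sigma> s \<and> acg_eta \<psi>s \<psi>n y0 s \<le> \<eta>bar)"

text \<open>
  With a stopping test \<open>P\<close> applied after each iteration \<open>k \<ge> 1\<close>: \<open>not_yet P k\<close> says that
  iteration \<open>k + 1\<close> is still carried out, \<open>first_hit P k\<close> that the run ends with iteration \<open>k\<close>.
\<close>

definition not_yet :: "(nat \<Rightarrow> bool) \<Rightarrow> nat \<Rightarrow> bool" where
  "not_yet P k \<longleftrightarrow> (\<forall>j. 1 \<le> j \<and> j \<le> k \<longrightarrow> \<not> P j)"

definition first_hit :: "(nat \<Rightarrow> bool) \<Rightarrow> nat \<Rightarrow> bool" where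
  "first_hit P k \<longleftrightarrow> 1 \<le> k \<and> P k \<and> (\<forall>j. 1 \<le> j \<and> j < k \<longrightarrow> \<not> P j)"

section \<open>Oracle calls\<close>

text \<open>
  \<open>Prox_h t c\<close> solves \<open>min t h(x) + |x - c|^2/2\<close>, and
  \<open>Max_Phi t x c\<close> solves \<open>max t \<Phi>(x,y) - |y - c|^2/2\<close> over \<open>Y\<close>.
\<close>

datatype ('a, 'b) query =
    is_Eval_Phi: Eval_Phi 'a 'b
  | is_Eval_grad: Eval_grad 'a 'b
  | is_Eval_h: Eval_h 'a
  | is_Prox_h: Prox_h real 'a
  | is_Max_Phi: Max_Phi real 'a 'b

text \<open>
  The two absolute constants behind the big-O symbols are fixed explicitly. An existential
  quantifier inside a theorem that is polymorphic in the two spaces would let them depend on the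
  dimensions. Their numerical values carry no significance.
\<close>

definition oracle_call_size :: nat where
  "oracle_call_size = 20"

definition big_O_const :: real where
  "big_O_const = 10 ^ 6"

definition big_O :: "ereal \<Rightarrow> ereal \<Rightarrow> bool" where
  "big_O t B \<longleftrightarrow> t \<le> ereal big_O_const * max 1 B"

definition oracle_call :: "('a, 'b) query list \<Rightarrow> bool" where
  "oracle_call c \<longleftrightarrow> length c \<le> oracle_call_size \<and>
     (\<exists>q\<in>set c. is_Eval_Phi q) \<and> (\<exists>q\<in>set c. is_Eval_grad q) \<and> (\<exists>q\<in>set c. is_Eval_h q) \<and>
     (\<exists>q\<in>set c. is_Prox_h q) \<and> (\<exists>q\<in>set c. is_Max_Phi q)"

text \<open>A log of oracle queries amounts to \<open>N\<close> oracle calls if it splits into \<open>N\<close> of them.\<close>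

definition performs_oracle_calls :: "nat \<Rightarrow> ('a, 'b) query list \<Rightarrow> bool" where
  "performs_oracle_calls N qs \<longleftrightarrow>
     (\<exists>cs. length cs = N \<and> concat cs = qs \<and> (\<forall>c\<in>set cs. oracle_call c))"

definition log1_plus :: "real \<Rightarrow> real" where
  "log1_plus t = max 1 (ln t)"

definition Omega_xi :: "real \<Rightarrow> real \<Rightarrow> real \<Rightarrow> real \<Rightarrow> real" where
  "Omega_xi m Lx Ly \<xi> = 1 + (sqrt \<xi> * Ly + sqrt Lx) / sqrt m"

section \<open>The AIPP.S method\<close>

locale aipp_s =
  fixes Y :: "'b::euclidean_space set" and \<Phi> :: "'a::euclidean_space \<Rightarrow> 'b \<Rightarrow> real"
    and h :: "'a \<Rightarrow> ereal" and m Lx Ly :: real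
    and y0 :: 'b and \<xi> \<rho> :: real
begin

definition lam :: real where "lam = 1 / (2 * m)"
definition sigma :: real where "sigma = 1 / 2"
definition M :: real where "M = Ly * (\<xi> * Ly + sqrt (\<xi> * (Lx + m))) + Lx"
definition mu :: real where "mu = 1 - lam * m"
definition L :: real where "L = 1 + lam * M"
definition rho_bar :: real where "rho_bar = \<rho> / 4"
definition L_bar :: real where "L_bar = max m M + 1 / lam"
definition eps_bar :: real where "eps_bar = \<rho>\<^sup>2 / (32 * (max m M + 1 / lam))"

definition f :: "'a \<Rightarrow> real" where
  "f x = (SUP y\<in>Y. \<Phi> x y - 1 / (2 * \<xi>) * (norm (y - y0))\<^sup>2)"

definition y_xi :: "'a \<Rightarrow> 'b" where
  "y_xi x = (ARG_MAX (\<lambda>y. \<Phi> x y - 1 / (2 * \<xi>) * (norm (y - y0))\<^sup>2) y. y \<in> Y)"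

definition psi_s :: "'a \<Rightarrow> 'a \<Rightarrow> real" where
  "psi_s z u = lam * f u + (norm (u - z))\<^sup>2 / 2"

definition psi_n :: "'a \<Rightarrow> ereal" where
  "psi_n u = ereal lam * h u"

definition state :: "'a \<Rightarrow> nat \<Rightarrow> 'a acg_state" where
  "state z k = acg_iter (psi_s z) psi_n z mu L k"

definition stop1 :: "'a \<Rightarrow> nat \<Rightarrow> bool" where
  "stop1 z = acg1_stop (psi_s z) psi_n z mu L sigma"

definition stop2 :: "'a \<Rightarrow> nat \<Rightarrow> bool" where
  "stop2 z = acg2_stop (psi_s z) psi_n z mu L sigma (lam * eps_bar)"

text \<open>\<open>small_res z k\<close>: the test that lets ACG2 be called, for the ACG1 output of iteration \<open>k\<close>.\<close>

definition small_res :: "'a \<Rightarrow> nat \<Rightarrow> bool" where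
  "small_res z k \<longleftrightarrow>
     norm (z - acgy (state z k) + acg_r z (state z k)) \<le> lam * rho_bar / 5"

definition refine_x :: "'a \<Rightarrow> 'a" where
  "refine_x z =
     (ARG_MIN (\<lambda>x'. ereal (lin f z x') + h x' + ereal (L_bar / 2 * (norm (x' - z))\<^sup>2)) x'. True)"

definition refine_u :: "'a \<Rightarrow> 'a" where
  "refine_u z = L_bar *\<^sub>R (z - refine_x z) + grad f (refine_x z) - grad f z"

text \<open>
  Oracle queries. With \<open>y = y_xi u\<close> the answer to \<open>Max_Phi \<xi> u y0\<close>, one has
  \<open>f u = \<Phi> u y - |y - y0|^2/(2 \<xi>)\<close> and \<open>grad f u = grad_x \<Phi> u y\<close>. Completing the square turns
  the minimizations defining \<open>y\<^sub>k\<close> and \<open>refine_x z\<close> into the displayed \<open>Prox_h\<close> queries.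
\<close>

definition value_queries :: "'a \<Rightarrow> ('a, 'b) query list" where
  "value_queries u = [Max_Phi \<xi> u y0, Eval_Phi u (y_xi u)]"

definition grad_queries :: "'a \<Rightarrow> ('a, 'b) query list" where
  "grad_queries u = [Max_Phi \<xi> u y0, Eval_grad u (y_xi u)]"

text \<open>Queries of the \<open>k\<close>-th ACG iteration, \<open>k \<ge> 1\<close>, including its stopping test.\<close>

definition acg_queries :: "'a \<Rightarrow> nat \<Rightarrow> ('a, 'b) query list" where
  "acg_queries z k =
     (let xt = acg_extrap mu L (state z (k - 1)); y = acgy (state z k) in
        value_queries xt @ grad_queries xt @
        [Prox_h (lam / (L + mu)) (xt - (1 / (L + mu)) *\<^sub>R grad (psi_s z) xt), Eval_h y] @
        value_queries y)"

definition acg_run_queries :: "'a \<Rightarrow> nat \<Rightarrow> ('a, 'b) query list" where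
  "acg_run_queries z k = concat (map (acg_queries z) [1..<Suc k])"

definition refine_queries :: "'a \<Rightarrow> ('a, 'b) query list" where
  "refine_queries z =
     grad_queries z @ [Prox_h (1 / L_bar) (z - (1 / L_bar) *\<^sub>R grad f z)] @ grad_queries (refine_x z)"

text \<open>
  \<open>outputs z x u qs\<close>: started from the prox center \<open>z\<close>, the method stops, outputs \<open>(x, u)\<close> and
  has made the queries \<open>qs\<close>. ACG2 is run from scratch, so its iterations are counted in full.
\<close>

inductive outputs :: "'a \<Rightarrow> 'a \<Rightarrow> 'a \<Rightarrow> ('a, 'b) query list \<Rightarrow> bool" where
  stop: "\<lbrakk>first_hit (stop1 z) k; small_res z k; first_hit (stop2 z) k'; z' = acgy (state z k')\<rbrakk>
    \<Longrightarrow> outputs z (refine_x z') (refine_u z')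
          (acg_run_queries z k @ acg_run_queries z k' @ refine_queries z')"
| continue: "\<lbrakk>first_hit (stop1 z) k; \<not> small_res z k; outputs (acgy (state z k)) x u qs\<rbrakk>
    \<Longrightarrow> outputs z x u (acg_run_queries z k @ qs)"

text \<open>The prox centers \<open>z\<^sub>0, z\<^sub>1, \<dots>\<close> of the run started at \<open>x0\<close>.\<close>

inductive center :: "'a \<Rightarrow> 'a \<Rightarrow> bool" for x0 where
  init: "center x0 x0"
| step: "\<lbrakk>center x0 z; first_hit (stop1 z) k; \<not> small_res z k\<rbrakk> \<Longrightarrow> center x0 (acgy (state z k))"

text \<open>
  The extrapolated points at which the ACG runs of the method evaluate \<open>grad f\<close>. They are affine
  combinations of points of \<open>X\<close>, but in general need not lie in \<open>X\<close>, nor in \<open>\<Omega>\<close>.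
\<close>

inductive_set acg_points :: "'a \<Rightarrow> 'a set" for x0 where
  acg1: "\<lbrakk>center x0 z; not_yet (stop1 z) k\<rbrakk> \<Longrightarrow> acg_extrap mu L (state z k) \<in> acg_points x0"
| acg2: "\<lbrakk>center x0 z; first_hit (stop1 z) k'; small_res z k'; not_yet (stop2 z) k\<rbrakk>
    \<Longrightarrow> acg_extrap mu L (state z k) \<in> acg_points x0"

end

end

theory Submission
  imports Defs
begin

text \<open>
  Fix an accelerated gradient run with start \<open>x\<^sub>0\<close>, and let \<open>w\<^sub>k = x\<^sub>0 - y\<^sub>k + r\<^sub>k\<close>. The estimate sequence gives
  \<open>A\<^sub>k \<psi>(y\<^sub>k) + (1 + \<mu> A\<^sub>k) |u - x\<^sub>k|\<^sup>2 / 2 \<le> A\<^sub>k \<psi>(u) + |u - x\<^sub>0|\<^sup>2 / 2\<close> on \<open>X\<close>. A point \<open>y\<^sub>j\<close> with \<open>A\<^sub>j \<ge> 18\<close>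
  minimizes \<open>\<psi>\<close> up to \<open>|x\<^sub>0 - y\<^sub>j|\<^sup>2 / 4\<close>, so all \<open>x\<^sub>k\<close>, and their convex combinations \<open>y\<^sub>k\<close>, lie in the
  ball around \<open>y\<^sub>j\<close> through \<open>x\<^sub>0\<close>. Hence the residual \<open>w\<^sub>j\<close> of ACG1 controls, up to a factor \<open>5\<close>, every later or
  earlier residual that passes the relative error test, and \<open>\<eta>\<^sub>k = O(|w\<^sub>j|\<^sup>2 / A\<^sub>k)\<close>. As \<open>A\<^sub>k\<close> grows
  quadratically and geometrically, ACG1 takes \<open>O(sqrt L)\<close> iterations, and ACG2, which needs
  \<open>A\<^sub>k \<ge> 8 L\<close>, takes \<open>O(sqrt L log L)\<close>. An ACG1 run with a large residual decreases \<open>f + h\<close> by a fixed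
  amount, and after the first run the gap of \<open>f + h\<close> is at most a multiple of the Moreau gap at \<open>x\<^sub>0\<close>, up to
  the smoothing error; this bounds the number of runs.
\<close>

section \<open>Strongly convex minimization\<close>

text \<open>Write \<open>F = f + h\<close>. Even when the Moreau gap at \<open>x0\<close> is
  moderate, \<open>F x0\<close> may lie far above \<open>inf F\<close>, so descent alone cannot give
  (a). The first run is therefore compared with arbitrary points of \<open>X\<close>, over which the
  infimum in the Moreau gap is then taken. ACG2 is called because ACG1 had a small residual, yet it
  returns another iterate; the divisor 5 in the test pays for transferring the residual. In the
  refinement the residual and the error each contribute \<open>\<rho> / 4\<close> to
  \<open>L_bar * |x - z|\<close>, and the difference of gradients in \<open>u\<close> at most
  doubles the resulting \<open>\<rho> / 2\<close>. The threshold \<open>8 * L\<close> is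
  proportional to \<open>L\<close> because \<open>lam * L_bar = L\<close> makes
  \<open>lam * eps_bar\<close> equal to \<open>(lam * \<rho>)^2 / (32 * L)\<close>. Since
  extrapolated points may leave \<open>X\<close>, linearization bounds are available only at points
  that a run really visits. Termination and validity thus come together: as long as a test fails,
  the points are known to lie in \<open>D\<close>, and this forces the test to succeed
  eventually.\<close>

lemma le_of_one_minus_mult_le:
  fixes a b :: real
  assumes "\<And>t. 0 < t \<Longrightarrow> t < 1 \<Longrightarrow> (1 - t) * b \<le> a"
  shows "b \<le> a"
proof (rule tendsto_lowerbound)
  show "((\<lambda>t. a + t * b) \<longlongrightarrow> a) (at_right 0)"
    by (rule tendsto_eq_intros refl | simp)+
  have "eventually (\<lambda>t. 0 < t \<and> t < (1::real)) (at_right 0)"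
    by (simp add: eventually_at_right_less eventually_at_right_field) (meson zero_less_one)
  then show "eventually (\<lambda>t. b \<le> a + t * b) (at_right 0)"
    by eventually_elim (use assms in \<open>force simp: algebra_simps\<close>)
qed simp

lemma norm_convex_comb_sq:
  fixes x y z :: "'a::real_inner"
  shows "(norm ((1 - t) *\<^sub>R x + t *\<^sub>R y - z))\<^sup>2
    = (1 - t) * (norm (x - z))\<^sup>2 + t * (norm (y - z))\<^sup>2 - t * (1 - t) * (norm (y - x))\<^sup>2"
  unfolding power2_norm_eq_inner
  by (simp add: inner_diff_left inner_diff_right inner_add_left inner_add_right inner_commute algebra_simps power2_eq_square)

text \<open>The minimizer is compared with \<open>(1 - t) y + t u\<close>. The quadratic gains
  \<open>t (1 - t) \<kappa> / 2 |u - y|^2\<close> over linear interpolation; division by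
  \<open>t\<close> and the limit \<open>t = 0\<close> leave the full quadratic growth. The linear
  term makes the lemma fit proximal steps; for the maximizer \<open>y_xi\<close> it is zero.\<close>

lemma strongly_convex_min:
  fixes H :: "'a::real_inner \<Rightarrow> real"
  assumes "convex_on S H" "y \<in> S" "u \<in> S"
    and min: "\<And>u. u \<in> S \<Longrightarrow> H y + g \<bullet> (y - z) + \<kappa> / 2 * (norm (y - z))\<^sup>2
                 \<le> H u + g \<bullet> (u - z) + \<kappa> / 2 * (norm (u - z))\<^sup>2"
  shows "H y + g \<bullet> (y - z) + \<kappa> / 2 * (norm (y - z))\<^sup>2 + \<kappa> / 2 * (norm (u - y))\<^sup>2
           \<le> H u + g \<bullet> (u - z) + \<kappa> / 2 * (norm (u - z))\<^sup>2"
proof -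
  define c where "c = \<kappa> / 2"
  let ?q = "\<lambda>u. H u + g \<bullet> (u - z) + c * (norm (u - z))\<^sup>2"
  have min: "?q y \<le> ?q u" if "u \<in> S" for u using min[OF that] unfolding c_def .
  have "(1 - t) * (c * (norm (u - y))\<^sup>2) \<le> ?q u - ?q y" if t: "0 < t" "t < 1" for t
  proof -
    let ?v = "(1 - t) *\<^sub>R y + t *\<^sub>R u"
    have "?v \<in> S"
      using convex_on_imp_convex[OF assms(1)] assms(2,3) t by (simp add: convex_alt)
    then have "?q y \<le> ?q ?v" by (rule min)
    also have "H ?v \<le> (1 - t) * H y + t * H u"
      using convex_onD[OF assms(1)] t assms(2,3) by simp
    then have "?q ?v \<le> (1 - t) * H y + t * H u + g \<bullet> (?v - z) + c * (norm (?v - z))\<^sup>2"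
      by simp
    also have "\<dots> = (1 - t) * ?q y + t * ?q u - t * ((1 - t) * (c * (norm (u - y))\<^sup>2))"
      unfolding norm_convex_comb_sq
      by (simp add: inner_diff_right inner_add_right algebra_simps add_divide_distrib diff_divide_distrib)
    finally have "t * ((1 - t) * (c * (norm (u - y))\<^sup>2)) \<le> t * (?q u - ?q y)"
      by (simp add: algebra_simps)
    then show ?thesis using t by (simp add: mult_le_cancel_left_pos)
  qed
  then have "c * (norm (u - y))\<^sup>2 \<le> ?q u - ?q y"
    by (rule le_of_one_minus_mult_le)
  then show ?thesis unfolding c_def by simp
qed

section \<open>Lower semicontinuity and existence of proximal points\<close>

lemma lsc_attains_inf:
  fixes q :: "'a::metric_space \<Rightarrow> ereal"
  assumes "compact K" "K \<noteq> {}" and lsc: "\<And>x. q x \<le> Liminf (at x) q"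
  shows "\<exists>x\<in>K. \<forall>y\<in>K. q x \<le> q y"
proof (rule ccontr)
  assume "\<not> ?thesis"
  then have "\<forall>x\<in>K. \<exists>y\<in>K. q y < q x" by (force simp: not_le)
  then obtain Y where Y: "\<And>x. x \<in> K \<Longrightarrow> Y x \<in> K" "\<And>x. x \<in> K \<Longrightarrow> q (Y x) < q x" by metis
  have "\<exists>U. open U \<and> x \<in> U \<and> (\<forall>u\<in>U. q (Y x) < q u)" if "x \<in> K" for x
  proof -
    have "eventually (\<lambda>u. q (Y x) < q u) (at x)"
      using lsc[of x] Y(2)[OF that] by (auto simp: le_Liminf_iff)
    \<comment> \<open>\<open>Liminf (at x)\<close> ignores the value at \<open>x\<close> itself, so
      the strict inequality there is supplied separately.\<close>
    then show ?thesis
      using Y(2)[OF that] unfolding eventually_at_topological by (metis UNIV_I)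
  qed
  then obtain U where U: "\<And>x. x \<in> K \<Longrightarrow> open (U x)" "\<And>x. x \<in> K \<Longrightarrow> x \<in> U x"
    "\<And>x u. x \<in> K \<Longrightarrow> u \<in> U x \<Longrightarrow> q (Y x) < q u" by metis
  \<comment> \<open>Of the finitely many better values \<open>q (Y c)\<close> in a subcover one is
    smallest; but the point \<open>Y c\<close> attaining it lies in some \<open>U c'\<close>, where
    \<open>q\<close> exceeds \<open>q (Y c')\<close>.\<close>
  obtain C where C: "C \<subseteq> K" "finite C" "K \<subseteq> (\<Union>c\<in>C. U c)"
    using compactE_image[OF \<open>compact K\<close>, of K U] U by blast
  then have "C \<noteq> {}" using \<open>K \<noteq> {}\<close> by auto
  then obtain c where "is_arg_min (\<lambda>c. q (Y c)) (\<lambda>c. c \<in> C) c"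
    using ex_is_arg_min_if_finite[OF C(2)] by blast
  then have c: "c \<in> C" "\<And>c'. c' \<in> C \<Longrightarrow> q (Y c) \<le> q (Y c')"
    unfolding is_arg_min_linorder by auto
  have "Y c \<in> K" using c C Y by auto
  then obtain c' where "c' \<in> C" "Y c \<in> U c'" using C by auto
  then show False using U(3)[of c' "Y c"] c(2)[of c'] C by auto
qed

lemma closed_conv_ereal:
  assumes "closed_conv X h" "x \<in> X"
  shows "h x = ereal (real_of_ereal (h x))"
  using assms unfolding closed_conv_def by (simp add: ereal_real)

lemma closed_conv_outside:
  assumes "closed_conv X h" "x \<notin> X"
  shows "h x = \<infinity>"
  using assms unfolding closed_conv_def by blast

lemma closed_conv_convex_on:
  assumes "closed_conv X h"
  shows "convex_on X (\<lambda>x. real_of_ereal (h x))"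
  using assms unfolding closed_conv_def by blast

text \<open>Along a ray from a point of the domain, convexity turns the minimum over a unit ball into a
  linear minorant.\<close>

lemma closed_conv_linear_growth:
  fixes h :: "'a::euclidean_space \<Rightarrow> ereal"
  assumes h: "closed_conv X h" and x0: "x0 \<in> X"
  obtains C where "C \<ge> 0" "\<And>u. u \<in> X \<Longrightarrow> real_of_ereal (h u) \<ge> - C * (1 + norm (u - x0))"
proof -
  let ?H = "\<lambda>x. real_of_ereal (h x)"
  have cv: "convex_on X ?H" "convex X"
    using closed_conv_convex_on[OF h] convex_on_imp_convex by auto
  have "\<And>x. h x \<le> Liminf (at x) h" using h unfolding closed_conv_def by blast
  from lsc_attains_inf[OF compact_cball _ this, of x0 1]
  obtain xm where xm: "xm \<in> cball x0 1" "\<And>y. y \<in> cball x0 1 \<Longrightarrow> h xm \<le> h y" by auto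
  have "xm \<in> X"
    using xm(2)[of x0] closed_conv_ereal[OF h x0] closed_conv_outside[OF h, of xm] by force
  define B where "B = \<bar>?H xm\<bar>"
  have B: "?H y \<ge> - B" if "y \<in> X" "y \<in> cball x0 1" for y
  proof -
    have "ereal (?H xm) \<le> ereal (?H y)"
      using xm(2)[OF that(2)] closed_conv_ereal[OF h \<open>xm \<in> X\<close>] closed_conv_ereal[OF h that(1)] by simp
    then have "?H xm \<le> ?H y" by simp
    moreover have "- \<bar>?H xm\<bar> \<le> ?H xm" by linarith
    ultimately show ?thesis unfolding B_def by linarith
  qed
  define C where "C = B + \<bar>?H x0\<bar>"
  have "?H u \<ge> - C * (1 + norm (u - x0))" if u: "u \<in> X" for u
  proof (cases "norm (u - x0) \<le> 1")
    case True
    then have "?H u \<ge> - B" using B[OF u] by (simp add: dist_norm norm_minus_commute)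
    moreover have "B \<le> C * (1 + norm (u - x0))"
    proof -
      have "B \<le> C" "0 \<le> C * norm (u - x0)" unfolding C_def B_def by (auto simp del: abs_real_of_ereal)
      then show ?thesis by (simp add: algebra_simps)
    qed
    ultimately show ?thesis by simp
  next
    case False
    define n where "n = norm (u - x0)"
    have n: "n > 1" using False unfolding n_def by simp
    let ?v = "(1 - 1/n) *\<^sub>R x0 + (1/n) *\<^sub>R u"
    have v: "?v \<in> X" using cv(2) x0 u n by (simp add: convex_alt)
    have "?v - x0 = (1/n) *\<^sub>R (u - x0)" by (simp add: algebra_simps)
    then have "norm (?v - x0) = 1" using n unfolding n_def by force
    then have "- B \<le> ?H ?v" using B[OF v] by (simp add: dist_norm norm_minus_commute)
    also have "\<dots> \<le> (1 - 1/n) * ?H x0 + (1/n) * ?H u"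
      using convex_onD[OF cv(1), of "1 / n" x0 u] n x0 u by simp
    finally have "- B * n \<le> ((1 - 1/n) * ?H x0 + (1/n) * ?H u) * n"
      using n by (intro mult_right_mono) auto
    also have "\<dots> = (n - 1) * ?H x0 + ?H u" using n by (simp add: field_simps)
    finally have "?H u \<ge> - B * n - (n - 1) * ?H x0" by simp
    moreover have "(n - 1) * ?H x0 \<le> (n + 1) * \<bar>?H x0\<bar>"
    proof -
      have "(n - 1) * ?H x0 \<le> (n - 1) * \<bar>?H x0\<bar>"
        using n by (intro mult_left_mono) (auto simp del: abs_real_of_ereal)
      also have "\<dots> \<le> (n + 1) * \<bar>?H x0\<bar>"
        by (intro mult_right_mono) (auto simp del: abs_real_of_ereal)
      finally show ?thesis .
    qed
    moreover have "B * n \<le> B * (1 + n)" unfolding B_def by (intro mult_left_mono) (auto simp del: abs_real_of_ereal)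
    ultimately have "?H u \<ge> - (B * (1 + n)) - (n + 1) * \<bar>?H x0\<bar>" by simp
    then show ?thesis unfolding C_def n_def by (simp add: algebra_simps)
  qed
  moreover have "C \<ge> 0" unfolding C_def B_def by (simp del: abs_real_of_ereal)
  ultimately show thesis using that by blast
qed

lemma closed_conv_mult:
  fixes h :: "'a::euclidean_space \<Rightarrow> ereal"
  assumes h: "closed_conv X h" and c: "c > 0"
  shows "closed_conv X (\<lambda>u. ereal c * h u)"
  unfolding closed_conv_def
proof (intro conjI ballI allI impI)
  have lsc: "h x \<le> Liminf (at x) h" for x using h unfolding closed_conv_def by blast
  show "X \<noteq> {}" using h unfolding closed_conv_def by blast
  fix x
  show "\<bar>ereal c * h x\<bar> \<noteq> \<infinity>" if "x \<in> X"
    by (subst closed_conv_ereal[OF h that]) simp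
  show "ereal c * h x = \<infinity>" if "x \<notin> X"
    using closed_conv_outside[OF h that] c by simp
  show "convex_on X (\<lambda>x. real_of_ereal (ereal c * h x))"
    using convex_on_cmul[OF _ closed_conv_convex_on[OF h], of c] c by simp
  have "Liminf (at x) (\<lambda>u. ereal c * h u) = ereal c * Liminf (at x) h"
    by (rule Liminf_ereal_mult_left) (use c in auto)
  then show "ereal c * h x \<le> Liminf (at x) (\<lambda>u. ereal c * h u)"
    using lsc[of x] c by (simp add: ereal_mult_left_mono)
qed

lemma closed_conv_prox_exists:
  fixes h :: "'a::euclidean_space \<Rightarrow> ereal"
  assumes h: "closed_conv X h" and k: "\<kappa> > 0"
  obtains y where "y \<in> X" "\<And>u. u \<in> X \<Longrightarrow>
     real_of_ereal (h y) + g \<bullet> (y - z) + \<kappa> / 2 * (norm (y - z))\<^sup>2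
       \<le> real_of_ereal (h u) + g \<bullet> (u - z) + \<kappa> / 2 * (norm (u - z))\<^sup>2"
proof -
  let ?H = "\<lambda>x. real_of_ereal (h x)"
  let ?e = "\<lambda>u. g \<bullet> (u - z) + \<kappa> / 2 * (norm (u - z))\<^sup>2"
  let ?q = "\<lambda>u. ?H u + ?e u"
  let ?Q = "\<lambda>u. ereal (?e u) + h u"
  obtain x0 where x0: "x0 \<in> X" using h unfolding closed_conv_def by blast
  obtain C where C: "C \<ge> 0" "\<And>u. u \<in> X \<Longrightarrow> ?H u \<ge> - C * (1 + norm (u - x0))"
    using closed_conv_linear_growth[OF h x0] by blast
  have QX: "?Q u = ereal (?q u)" if "u \<in> X" for u
    using closed_conv_ereal[OF h that] by (metis add.commute plus_ereal.simps(1))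
  have lsc: "?Q x \<le> Liminf (at x) ?Q" for x
    unfolding le_Liminf_iff
  proof (intro allI impI)
    fix c assume "c < ?Q x"
    then have "c - ereal (?e x) < h x"
      by (cases c; cases "h x") auto
    then obtain b where b: "c - ereal (?e x) < ereal b" "ereal b < h x"
      using ereal_dense2 by blast
    have "((\<lambda>u. ereal (?e u + b)) \<longlongrightarrow> ereal (?e x + b)) (at x)"
      by (intro tendsto_intros)
    moreover have "c < ereal (?e x + b)" using b(1) by (cases c) auto
    ultimately have "\<forall>\<^sub>F u in at x. c < ereal (?e u + b)" by (rule order_tendstoD)
    moreover have "\<forall>\<^sub>F u in at x. ereal b < h u"
      using h b(2) unfolding closed_conv_def le_Liminf_iff by blast
    ultimately show "\<forall>\<^sub>F u in at x. c < ?Q u"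
    proof eventually_elim
      case (elim u)
      have "ereal (?e u + b) = ereal (?e u) + ereal b" by simp
      also have "\<dots> \<le> ?Q u" using elim(2) by (intro add_left_mono) simp
      finally show ?case using elim(1) by simp
    qed
  qed
  define a where "a = norm g + C"
  define b where "b = C * (1 + norm (x0 - z)) + ?q x0"
  have "a \<ge> 0" unfolding a_def using C by simp
  \<comment> \<open>The first entry puts \<open>x0\<close> into the ball. Beyond the second the
    quadratic outweighs the linear minorant; the summand 1 makes the norm exceed 1, so that the
    constant \<open>b\<close> is dominated by a multiple of the norm.\<close>
  define R where "R = max (norm (x0 - z)) ((2 * a + 2 * \<bar>b\<bar>) / \<kappa> + 1)"
  have far: "?q x0 < ?q u" if u: "u \<in> X" "norm (u - z) > R" for u
  proof -
    let ?n = "norm (u - z)"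
    have "(2 * a + 2 * \<bar>b\<bar>) / \<kappa> \<ge> 0" using \<open>a \<ge> 0\<close> k by simp
    then have n1: "?n > 1" "?n > (2 * a + 2 * \<bar>b\<bar>) / \<kappa>"
      using u(2) unfolding R_def by linarith+
    have "norm (u - x0) \<le> ?n + norm (x0 - z)"
      using norm_triangle_ineq[of "u - z" "z - x0"] by (simp add: norm_minus_commute)
    then have "C * (1 + norm (u - x0)) \<le> C * (1 + (?n + norm (x0 - z)))"
      using C(1) by (intro mult_left_mono) auto
    then have "?H u \<ge> - C * (1 + (?n + norm (x0 - z)))" using C(2)[OF u(1)] by simp
    moreover have "g \<bullet> (u - z) \<ge> - (norm g * ?n)"
      using Cauchy_Schwarz_ineq2[of g "u - z"] by linarith
    ultimately have 1: "?q u \<ge> \<kappa> / 2 * ?n\<^sup>2 - a * ?n - C * (1 + norm (x0 - z))"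
      unfolding a_def by (simp add: algebra_simps)
    have "(2 * a + 2 * \<bar>b\<bar>) < \<kappa> * ?n" using n1 k by (simp add: field_simps)
    then have "(2 * a + 2 * \<bar>b\<bar>) * ?n < \<kappa> * ?n * ?n" using n1 by (intro mult_strict_right_mono) auto
    moreover have "\<bar>b\<bar> \<le> \<bar>b\<bar> * ?n" using n1 mult_left_mono[of 1 ?n "\<bar>b\<bar>"] by simp
    ultimately have "\<kappa> / 2 * ?n\<^sup>2 - a * ?n > \<bar>b\<bar>" by (simp add: power2_eq_square algebra_simps)
    with 1 show ?thesis unfolding b_def by (simp add: b_def abs_if split: if_splits)
  qed
  have "x0 \<in> cball z R" unfolding R_def by (simp add: dist_norm norm_minus_commute)
  then obtain y where y: "y \<in> cball z R" "\<And>u. u \<in> cball z R \<Longrightarrow> ?Q y \<le> ?Q u"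
    using lsc_attains_inf[OF compact_cball _ lsc] by blast
  have yX: "y \<in> X"
  proof (rule ccontr)
    assume "y \<notin> X"
    then have "?Q y = \<infinity>" using closed_conv_outside[OF h] by simp
    then show False using y(2)[OF \<open>x0 \<in> cball z R\<close>] QX[OF x0] by simp
  qed
  have near: "?q y \<le> ?q u" if "u \<in> X" "u \<in> cball z R" for u
    using y(2)[OF that(2)] QX[OF that(1)] QX[OF yX] by simp
  have fin: "?q y \<le> ?q u" if "u \<in> X" for u
  proof (cases "norm (u - z) > R")
    case True
    then show ?thesis using far[OF that] near[OF x0 \<open>x0 \<in> cball z R\<close>] by linarith
  next
    case False
    then show ?thesis using near[OF that] by (simp add: dist_norm norm_minus_commute)
  qed
  show thesis
    by (rule that[OF yX], drule fin) (simp only: add.assoc)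
qed

text \<open>\<open>ARG_MIN\<close> is a choice operator, so a minimizer must exist before anything
  is known of it. The scale \<open>s\<close> and the constant \<open>d\<close> absorb the
  normalizations of the two uses: \<open>1 / L\<close> for an accelerated step, \<open>1\<close> for
  the refinement.\<close>

lemma closed_conv_prox_arg_min:
  fixes h :: "'a::euclidean_space \<Rightarrow> ereal"
  assumes h: "closed_conv X h" and k: "\<kappa> > 0" and s: "s > 0"
    and Q: "\<And>u. u \<in> X \<Longrightarrow> Q u = ereal (s * (real_of_ereal (h u) + g \<bullet> (u - z) + \<kappa> / 2 * (norm (u - z))\<^sup>2) + d)"
    and Qout: "\<And>u. u \<notin> X \<Longrightarrow> Q u = \<infinity>"
    and y: "y = (ARG_MIN Q u. True)"
  shows "y \<in> X"
    and "\<And>u. u \<in> X \<Longrightarrow> real_of_ereal (h y) + g \<bullet> (y - z) + \<kappa> / 2 * (norm (y - z))\<^sup>2 + \<kappa> / 2 * (norm (u - y))\<^sup>2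
       \<le> real_of_ereal (h u) + g \<bullet> (u - z) + \<kappa> / 2 * (norm (u - z))\<^sup>2"
proof -
  let ?q = "\<lambda>u. real_of_ereal (h u) + g \<bullet> (u - z) + \<kappa> / 2 * (norm (u - z))\<^sup>2"
  obtain y' where y': "y' \<in> X" "\<And>u. u \<in> X \<Longrightarrow> ?q y' \<le> ?q u"
    using closed_conv_prox_exists[OF h k, of g z] by blast
  have "Q y' \<le> Q u" for u
    using y' Q Qout s by (cases "u \<in> X") auto
  then have "is_arg_min Q (\<lambda>u. True) y'" unfolding is_arg_min_def by (simp add: not_less)
  then have "is_arg_min Q (\<lambda>u. True) y" unfolding y arg_min_def by (rule someI)
  then have yQ: "Q y \<le> Q u" for u unfolding is_arg_min_def by (simp add: not_less)
  show yX: "y \<in> X" using yQ[of y'] Q[OF y'(1)] Qout by force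
  have "?q y \<le> ?q u" if "u \<in> X" for u
    using yQ[of u] Q[OF that] Q[OF yX] s by simp
  then show "?q y + \<kappa> / 2 * (norm (u - y))\<^sup>2 \<le> ?q u" if "u \<in> X" for u
    by (intro strongly_convex_min[OF closed_conv_convex_on[OF h] yX that]) auto
qed

section \<open>Accelerated composite gradient iterations\<close>

declare acg_iter.simps(2) [simp del]

text \<open>The step is the positive root of \<open>a^2 = \<tau> (A + a)\<close> with
  \<open>\<tau> = (1 + \<mu> A) / L\<close>, and it is at least
  \<open>\<tau> / 2 + sqrt (\<tau> A)\<close>. The resulting increment of \<open>sqrt A\<close> is
  the source of both growth rates below.\<close>

lemma acg_step_props:
  assumes "\<mu> > 0" "L > 0" "A \<ge> 0"
  defines "a \<equiv> acg_step \<mu> L A"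
  shows "a > 0" "L * a\<^sup>2 = (1 + \<mu> * A) * (A + a)"
    and "sqrt (A + a) \<ge> sqrt A + sqrt ((1 + \<mu> * A) / L) / 2"
proof -
  define \<tau> where "\<tau> = (1 + \<mu> * A) / L"
  define r where "r = sqrt (\<tau>\<^sup>2 + 4 * \<tau> * A)"
  have \<tau>: "\<tau> > 0" unfolding \<tau>_def using assms by (simp add: add_pos_nonneg)
  have a: "a = (\<tau> + r) / 2" unfolding a_def acg_step_def Let_def \<tau>_def r_def ..
  have r0: "r \<ge> 0" and r2: "r\<^sup>2 = \<tau>\<^sup>2 + 4 * \<tau> * A"
    unfolding r_def using \<tau> \<open>A \<ge> 0\<close> by auto
  show "a > 0" using a r0 \<tau> by simp
  have "a\<^sup>2 = (\<tau>\<^sup>2 + 2 * \<tau> * r + r\<^sup>2) / 4" unfolding a by (simp add: power2_eq_square algebra_simps)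
  also have "\<dots> = \<tau> * (A + a)" unfolding r2 a by (simp add: power2_eq_square field_simps)
  finally show "L * a\<^sup>2 = (1 + \<mu> * A) * (A + a)" unfolding \<tau>_def using \<open>L > 0\<close> by simp
  have "2 * sqrt (\<tau> * A) \<le> r"
  proof -
    have "2 * sqrt (\<tau> * A) = sqrt (4 * \<tau> * A)" by (simp add: real_sqrt_mult)
    also have "\<dots> \<le> r" unfolding r_def by simp
    finally show ?thesis .
  qed
  then have "(sqrt A + sqrt \<tau> / 2)\<^sup>2 \<le> A + a"
    unfolding a using \<tau> \<open>A \<ge> 0\<close> by (simp add: power2_eq_square algebra_simps real_sqrt_mult)
  then show "sqrt (A + a) \<ge> sqrt A + sqrt ((1 + \<mu> * A) / L) / 2"
    unfolding \<tau>_def[symmetric] by (rule real_le_rsqrt)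
qed

lemma norm_sq_three_points:
  fixes u y z :: "'a::real_inner"
  shows "c / 2 * (norm (u - z))\<^sup>2
    = c / 2 * (norm (u - y))\<^sup>2 - c * ((z - y) \<bullet> (u - y)) + c / 2 * (norm (y - z))\<^sup>2"
proof -
  have "(norm (u - z))\<^sup>2 = (norm (u - y))\<^sup>2 + 2 * - ((z - y) \<bullet> (u - y)) + (norm (y - z))\<^sup>2"
    unfolding power2_norm_eq_inner by (simp add: algebra_simps inner_commute)
  then have "c / 2 * (norm (u - z))\<^sup>2
    = c / 2 * ((norm (u - y))\<^sup>2 + 2 * - ((z - y) \<bullet> (u - y)) + (norm (y - z))\<^sup>2)" by simp
  then show ?thesis by (simp add: distrib_left right_diff_distrib del: inner_diff_left inner_diff_right)
qed

text \<open>The hypothesis says that the gradient in \<open>u\<close> of the left-hand side vanishes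
  at \<open>x'\<close>; hence the expansion around \<open>x'\<close> has no linear term.\<close>

lemma quadratic_shift:
  fixes x y z x' u :: "'a::real_inner"
  assumes "(s + a * \<mu>) *\<^sub>R (x' - x) = a *\<^sub>R (L *\<^sub>R (y - z) + \<mu> *\<^sub>R (y - x))"
  shows "s / 2 * (norm (u - x))\<^sup>2 + a * (L * ((z - y) \<bullet> (u - y)) + \<mu> / 2 * (norm (u - y))\<^sup>2)
    = s / 2 * (norm (x' - x))\<^sup>2 + a * (L * ((z - y) \<bullet> (x' - y)) + \<mu> / 2 * (norm (x' - y))\<^sup>2)
      + (s + a * \<mu>) / 2 * (norm (u - x'))\<^sup>2"
proof -
  define d where "d = u - x'"
  have u: "u = x' + d" unfolding d_def by simp
  have 1: "(norm (u - v))\<^sup>2 = (norm (x' - v))\<^sup>2 + 2 * ((x' - v) \<bullet> d) + (norm d)\<^sup>2" for v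
    unfolding u power2_norm_eq_inner by (simp add: algebra_simps inner_commute)
  have "((s + a * \<mu>) *\<^sub>R (x' - x)) \<bullet> d = (a *\<^sub>R (L *\<^sub>R (y - z) + \<mu> *\<^sub>R (y - x))) \<bullet> d"
    using assms by simp
  then have 2: "s * ((x' - x) \<bullet> d) + a * (L * ((z - y) \<bullet> d) + \<mu> * ((x' - y) \<bullet> d)) = 0"
    by (simp add: algebra_simps)
  have "(z - y) \<bullet> (u - y) = (z - y) \<bullet> (x' - y) + (z - y) \<bullet> d"
    unfolding u by (simp add: algebra_simps)
  then have "s / 2 * (norm (u - x))\<^sup>2 + a * (L * ((z - y) \<bullet> (u - y)) + \<mu> / 2 * (norm (u - y))\<^sup>2)
     = s / 2 * (norm (x' - x))\<^sup>2 + a * (L * ((z - y) \<bullet> (x' - y)) + \<mu> / 2 * (norm (x' - y))\<^sup>2)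
      + (s + a * \<mu>) / 2 * (norm d)\<^sup>2
      + (s * ((x' - x) \<bullet> d) + a * (L * ((z - y) \<bullet> d) + \<mu> * ((x' - y) \<bullet> d)))"
    unfolding 1[of x] 1[of y] by (simp add: field_simps)
  then show ?thesis unfolding 2 unfolding d_def by simp
qed

text \<open>\<open>D\<close> is the set on which the linearizations of \<open>\<psi>s\<close> are controlled; the extrapolated points may
  leave \<open>X\<close>.\<close>

locale acg =
  fixes X D :: "'a::euclidean_space set" and \<psi>s :: "'a \<Rightarrow> real" and \<psi>n :: "'a \<Rightarrow> ereal"
    and x0 :: 'a and \<mu> L :: real
  assumes \<psi>n: "closed_conv X \<psi>n" and x0: "x0 \<in> X" and \<mu>: "\<mu> > 0" and L: "L > 0"
    and lower: "\<And>z u. z \<in> D \<Longrightarrow> u \<in> X \<Longrightarrow> lin \<psi>s z u + \<mu> / 2 * (norm (u - z))\<^sup>2 \<le> \<psi>s u"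
    and upper: "\<And>z u. z \<in> D \<Longrightarrow> u \<in> X \<Longrightarrow> \<psi>s u \<le> lin \<psi>s z u + L / 2 * (norm (u - z))\<^sup>2"
begin

abbreviation "S k \<equiv> acg_iter \<psi>s \<psi>n x0 \<mu> L k"
abbreviation "A k \<equiv> acgA (S k)"
abbreviation "x k \<equiv> acgx (S k)"
abbreviation "y k \<equiv> acgy (S k)"
abbreviation "\<Gamma> k \<equiv> acgG (S k)"
abbreviation "a k \<equiv> acg_step \<mu> L (A k)"
abbreviation "xt k \<equiv> acg_extrap \<mu> L (S k)"
abbreviation "r k \<equiv> acg_r x0 (S k)"
abbreviation "\<eta> k \<equiv> acg_eta \<psi>s \<psi>n x0 (S k)"

definition H :: "'a \<Rightarrow> real" where "H u = real_of_ereal (\<psi>n u)"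
definition \<psi> :: "'a \<Rightarrow> real" where "\<psi> u = \<psi>s u + H u"
definition q :: "nat \<Rightarrow> 'a \<Rightarrow> real" where
  "q k u = lin \<psi>s (xt k) u + H u + \<mu> / 2 * (norm (u - xt k))\<^sup>2"
definition \<gamma> :: "nat \<Rightarrow> 'a \<Rightarrow> real" where
  "\<gamma> k u = q k (y (Suc k)) + L * ((xt k - y (Suc k)) \<bullet> (u - y (Suc k))) + \<mu> / 2 * (norm (u - y (Suc k)))\<^sup>2"
text \<open>By \<open>\<Gamma>_quadratic\<close> this is the minimum over \<open>u\<close> of
  \<open>A k * \<Gamma> k u + |u - x0|^2 / 2\<close>, attained at \<open>x k\<close>.\<close>

definition c :: "nat \<Rightarrow> real" where
  "c k = A k * \<Gamma> k (x k) + (norm (x k - x0))\<^sup>2 / 2"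

text \<open>Only the points linearized in the first \<open>k\<close> iterations are constrained: a
  run may stop there, and later points need not lie in \<open>D\<close>.\<close>

definition valid :: "nat \<Rightarrow> bool" where "valid k \<longleftrightarrow> (\<forall>i<k. xt i \<in> D)"

section \<open>Growth of the coefficients \<open>A k\<close>\<close>

lemma A_Suc: "A (Suc k) = A k + a k"
  by (simp add: acg_iter.simps(2) acg_next_def Let_def)

lemma A_nonneg: "A k \<ge> 0"
proof (induction k)
  case (Suc k)
  then show ?case using acg_step_props(1)[OF \<mu> L Suc] unfolding A_Suc by simp
qed simp

lemmas a_pos = acg_step_props(1)[OF \<mu> L A_nonneg]
lemmas a_square = acg_step_props(2)[OF \<mu> L A_nonneg]

lemma A_Suc_pos: "A (Suc k) > 0"
  using a_pos[of k] A_nonneg[of k] unfolding A_Suc by simp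

lemma A_pos: "k \<ge> 1 \<Longrightarrow> A k > 0"
  using A_Suc_pos by (cases k) auto

lemma sqrt_A_Suc: "sqrt (A (Suc k)) \<ge> sqrt (A k) + sqrt ((1 + \<mu> * A k) / L) / 2"
  using acg_step_props(3)[OF \<mu> L A_nonneg] unfolding A_Suc .

lemma A_ge_square: "A k \<ge> (real k)\<^sup>2 / (4 * L)"
proof -
  have "sqrt (A k) \<ge> real k / (2 * sqrt L)"
  proof (induction k)
    case (Suc k)
    have "1 / L \<le> (1 + \<mu> * A k) / L"
      using A_nonneg[of k] \<mu> L by (simp add: divide_right_mono)
    then have "1 / sqrt L \<le> sqrt ((1 + \<mu> * A k) / L)"
      by (metis real_sqrt_divide real_sqrt_le_mono real_sqrt_one)
    then have "real k / (2 * sqrt L) + 1 / sqrt L / 2 \<le> sqrt (A k) + sqrt ((1 + \<mu> * A k) / L) / 2"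
      using Suc by (intro add_mono divide_right_mono) auto
    also note sqrt_A_Suc
    finally have "real k / (2 * sqrt L) + 1 / sqrt L / 2 \<le> sqrt (A (Suc k))" .
    then show ?case by (simp add: add_divide_distrib add.commute)
  qed (use A_nonneg in simp)
  then have "(real k / (2 * sqrt L))\<^sup>2 \<le> (sqrt (A k))\<^sup>2"
    using L by (intro power_mono) auto
  then have "(real k / (2 * sqrt L))\<^sup>2 \<le> A k" using A_nonneg[of k] by simp
  then show ?thesis using L by (simp add: power_divide power_mult_distrib)
qed

text \<open>Of \<open>1 + \<mu> * A k\<close> only \<open>\<mu> * A k\<close> is kept, while the
  quadratic bound keeps only the 1. A multiplicative recursion cannot start from
  \<open>A 0 = 0\<close>; it starts from \<open>A 1 = 1 / L\<close>, which explains the shifted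
  index.\<close>

lemma A_ge_geometric: "A (Suc k) \<ge> (1 + sqrt (\<mu> / L) / 2) ^ (2 * k) / L"
proof -
  let ?s = "1 + sqrt (\<mu> / L) / 2"
  have s: "?s \<ge> 0" using \<mu> L by (simp add: add_nonneg_nonneg)
  have "sqrt (A (Suc k)) \<ge> ?s ^ k / sqrt L"
  proof (induction k)
    case 0
    have "sqrt (A 1) \<ge> sqrt (1 / L)"
      using a_square[of 0] a_pos[of 0] L A_Suc[of 0] by (simp add: power2_eq_square field_simps)
    then show ?case by (simp add: real_sqrt_divide)
  next
    case (Suc k)
    have "\<mu> * A (Suc k) / L \<le> (1 + \<mu> * A (Suc k)) / L"
      using L by (simp add: divide_right_mono)
    then have "sqrt (\<mu> / L) * sqrt (A (Suc k)) \<le> sqrt ((1 + \<mu> * A (Suc k)) / L)"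
      by (metis real_sqrt_le_mono real_sqrt_mult times_divide_eq_left)
    then have "sqrt (A (Suc (Suc k))) \<ge> ?s * sqrt (A (Suc k))"
      using sqrt_A_Suc[of "Suc k"] by (simp add: algebra_simps)
    also have "?s * (?s ^ k / sqrt L) \<le> ?s * sqrt (A (Suc k))"
      using Suc s by (rule mult_left_mono)
    finally (xtrans) show ?case by simp
  qed
  then have "(?s ^ k / sqrt L)\<^sup>2 \<le> (sqrt (A (Suc k)))\<^sup>2"
    using s L by (intro power_mono) auto
  then show ?thesis using L A_nonneg[of "Suc k"] by (simp add: power_divide power_mult mult.commute flip: power_mult)
qed

section \<open>Estimate sequence: minorants, quadratic form and basic invariant\<close>

lemma
  shows y_Suc_in: "y (Suc k) \<in> X"
    and \<gamma>_le_q: "u \<in> X \<Longrightarrow> \<gamma> k u \<le> q k u"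
proof -
  let ?z = "xt k" and ?g = "grad \<psi>s (xt k)"
  let ?Q = "\<lambda>u. ereal (1 / L) * (ereal (lin \<psi>s ?z u) + \<psi>n u + ereal (\<mu> / 2 * (norm (u - ?z))\<^sup>2))
      + ereal ((norm (u - ?z))\<^sup>2 / 2)"
  have k: "L + \<mu> > 0" and s: "1 / L > 0" using L \<mu> by auto
  have Q: "?Q u = ereal (1 / L * (real_of_ereal (\<psi>n u) + ?g \<bullet> (u - ?z) + (L + \<mu>) / 2 * (norm (u - ?z))\<^sup>2) + \<psi>s ?z / L)"
    if u: "u \<in> X" for u
  proof -
    obtain v where v: "\<psi>n u = ereal v" using closed_conv_ereal[OF \<psi>n u] by blast
    show ?thesis unfolding v lin_def using L by (simp add: field_simps)
  qed
  have Qout: "?Q u = \<infinity>" if "u \<notin> X" for u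
    using closed_conv_outside[OF \<psi>n that] L by simp
  have y': "y (Suc k) = (ARG_MIN ?Q u. True)"
    by (simp add: acg_iter.simps(2) acg_next_def Let_def)
  note min = closed_conv_prox_arg_min[OF \<psi>n k s Q Qout y']
  show "y (Suc k) \<in> X" using min(1) by blast
  let ?y = "y (Suc k)"
  assume u: "u \<in> X"
  \<comment> \<open>The minimality of \<open>y (Suc k)\<close> has modulus \<open>L + \<mu>\<close>.
    Expanding \<open>L / 2 |u - z|^2\<close> around \<open>y (Suc k)\<close> cancels the
    \<open>L\<close> part of the growth and leaves exactly the linear and the \<open>\<mu>\<close>
    term of \<open>\<gamma>\<close>.\<close>
  note norm_sq_three_points[of L u ?z ?y]
  moreover have "H ?y + ?g \<bullet> (?y - ?z) + (L + \<mu>) / 2 * (norm (?y - ?z))\<^sup>2 + (L + \<mu>) / 2 * (norm (u - ?y))\<^sup>2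
     \<le> H u + ?g \<bullet> (u - ?z) + (L + \<mu>) / 2 * (norm (u - ?z))\<^sup>2"
    unfolding H_def using min(2) u by blast
  ultimately show "\<gamma> k u \<le> q k u"
    unfolding \<gamma>_def q_def lin_def distrib_right add_divide_distrib by linarith
qed

lemma y_in: "y k \<in> X"
  using x0 y_Suc_in by (cases k) auto

lemma \<Gamma>_Suc: "A (Suc k) * \<Gamma> (Suc k) u = A k * \<Gamma> k u + a k * \<gamma> k u"
proof -
  obtain v where v: "\<psi>n (y (Suc k)) = ereal v" using closed_conv_ereal[OF \<psi>n y_Suc_in] by blast
  have "q k (y (Suc k)) = real_of_ereal (ereal (lin \<psi>s (xt k) (y (Suc k))) + \<psi>n (y (Suc k))
     + ereal (\<mu> / 2 * (norm (y (Suc k) - xt k))\<^sup>2))"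
    unfolding q_def H_def v by simp
  moreover have "\<Gamma> (Suc k) u = A k / A (Suc k) * \<Gamma> k u + a k / A (Suc k) *
      (real_of_ereal (ereal (lin \<psi>s (xt k) (y (Suc k))) + \<psi>n (y (Suc k))
     + ereal (\<mu> / 2 * (norm (y (Suc k) - xt k))\<^sup>2)) + L * ((xt k - y (Suc k)) \<bullet> (u - y (Suc k)))
     + \<mu> / 2 * (norm (u - y (Suc k)))\<^sup>2)"
    by (simp add: acg_iter.simps(2) acg_next_def Let_def)
  ultimately have "\<Gamma> (Suc k) u = A k / A (Suc k) * \<Gamma> k u + a k / A (Suc k) * \<gamma> k u"
    unfolding \<gamma>_def by simp
  then show ?thesis using A_Suc_pos[of k] by (simp add: field_simps)
qed

lemma x_Suc: "(1 + \<mu> * A (Suc k)) *\<^sub>R (x (Suc k) - x k)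
    = a k *\<^sub>R (L *\<^sub>R (y (Suc k) - xt k) + \<mu> *\<^sub>R (y (Suc k) - x k))"
proof -
  have "x (Suc k) = x k + (a k / (1 + \<mu> * A (Suc k))) *\<^sub>R (L *\<^sub>R (y (Suc k) - xt k) + \<mu> *\<^sub>R (y (Suc k) - x k))"
    by (simp add: acg_iter.simps(2) acg_next_def Let_def)
  moreover have "1 + \<mu> * A (Suc k) > 0" using \<mu> A_Suc_pos[of k] by (simp add: add_pos_pos)
  ultimately show ?thesis by simp
qed

lemma xt_eq: "A (Suc k) *\<^sub>R xt k = A k *\<^sub>R y k + a k *\<^sub>R x k"
  using A_Suc_pos[of k] unfolding acg_extrap_def Let_def A_Suc by (simp add: scaleR_add_right)

text \<open>The update \<open>x_Suc\<close> is the stationarity condition of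
  \<open>quadratic_shift\<close>. The constant stays existential during the induction, so that its
  recursion need not be computed; evaluation at \<open>u = x k\<close> identifies it.\<close>

lemma \<Gamma>_quadratic:
  "A k * \<Gamma> k u + (norm (u - x0))\<^sup>2 / 2 = c k + (1 + \<mu> * A k) / 2 * (norm (u - x k))\<^sup>2"
proof -
  have "\<exists>c. \<forall>u. A k * \<Gamma> k u + (norm (u - x0))\<^sup>2 / 2 = c + (1 + \<mu> * A k) / 2 * (norm (u - x k))\<^sup>2"
  proof (induction k)
    case (Suc k)
    then obtain c where c: "\<And>u. A k * \<Gamma> k u + (norm (u - x0))\<^sup>2 / 2 = c + (1 + \<mu> * A k) / 2 * (norm (u - x k))\<^sup>2"
      by blast
    have s: "1 + \<mu> * A k + a k * \<mu> = 1 + \<mu> * A (Suc k)" unfolding A_Suc by (simp add: algebra_simps)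
    note shift = quadratic_shift[of "1 + \<mu> * A k" "a k" \<mu> "x (Suc k)" "x k" L "y (Suc k)" "xt k", unfolded s, OF x_Suc]
    show ?case
    proof (intro exI allI)
      fix u
      have "A (Suc k) * \<Gamma> (Suc k) u + (norm (u - x0))\<^sup>2 / 2
        = c + a k * q k (y (Suc k)) + ((1 + \<mu> * A k) / 2 * (norm (u - x k))\<^sup>2
          + a k * (L * ((xt k - y (Suc k)) \<bullet> (u - y (Suc k))) + \<mu> / 2 * (norm (u - y (Suc k)))\<^sup>2))"
        using c[of u] unfolding \<Gamma>_Suc \<gamma>_def by (simp add: algebra_simps)
      also note shift
      finally show "A (Suc k) * \<Gamma> (Suc k) u + (norm (u - x0))\<^sup>2 / 2 =
        (c + a k * q k (y (Suc k)) + ((1 + \<mu> * A k) / 2 * (norm (x (Suc k) - x k))\<^sup>2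
          + a k * (L * ((xt k - y (Suc k)) \<bullet> (x (Suc k) - y (Suc k))) + \<mu> / 2 * (norm (x (Suc k) - y (Suc k)))\<^sup>2)))
        + (1 + \<mu> * A (Suc k)) / 2 * (norm (u - x (Suc k)))\<^sup>2" by simp
    qed
  qed auto
  then obtain c' where c': "\<And>u. A k * \<Gamma> k u + (norm (u - x0))\<^sup>2 / 2 = c' + (1 + \<mu> * A k) / 2 * (norm (u - x k))\<^sup>2"
    by blast
  from c'[of "x k"] have "c k = c'" unfolding c_def by simp
  with c' show ?thesis by simp
qed

lemma q_le_\<psi>: "xt k \<in> D \<Longrightarrow> u \<in> X \<Longrightarrow> q k u \<le> \<psi> u"
  using lower[of "xt k" u] unfolding q_def \<psi>_def by simp

lemma \<Gamma>_le_\<psi>: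
  assumes "valid k" "u \<in> X"
  shows "A k * \<Gamma> k u \<le> A k * \<psi> u"
  using assms(1)
proof (induction k)
  case (Suc k)
  then have "A k * \<Gamma> k u \<le> A k * \<psi> u" "xt k \<in> D" unfolding valid_def by auto
  moreover have "a k * \<gamma> k u \<le> a k * \<psi> u"
    using \<gamma>_le_q[OF assms(2), of k] q_le_\<psi>[OF \<open>xt k \<in> D\<close> assms(2)] a_pos[of k]
    by (intro mult_left_mono) auto
  ultimately have "A (Suc k) * \<Gamma> (Suc k) u \<le> (A k + a k) * \<psi> u"
    unfolding \<Gamma>_Suc by (simp add: distrib_right)
  then show ?case unfolding A_Suc .
qed simp

text \<open>This is the estimate sequence invariant. The upper bound at the new iterate costs
  \<open>L / 2 |v - z|^2\<close> for an auxiliary point \<open>v\<close>, and the strong convexity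
  of the estimate function around \<open>x k\<close> repays precisely this amount, by the equation
  for \<open>a k\<close>.\<close>

lemma \<psi>_y_le:
  assumes "valid k"
  shows "A k * \<psi> (y k) \<le> c k"
  using assms
proof (induction k)
  case 0
  show ?case unfolding c_def by simp
next
  case (Suc k)
  let ?y = "y (Suc k)" and ?x = "x (Suc k)" and ?z = "xt k" and ?A = "A (Suc k)"
  let ?s = "1 + \<mu> * A k"
  have IH: "A k * \<psi> (y k) \<le> c k" and zD: "?z \<in> D" using Suc unfolding valid_def by auto
  have A0: "?A > 0" by (rule A_Suc_pos)
  define t where "t = a k / ?A"
  have t: "0 \<le> t" "t \<le> 1" "t * ?A = a k" "(1 - t) * ?A = A k"
    unfolding t_def using A0 a_pos[of k] A_nonneg[of k] by (auto simp: A_Suc field_simps)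
  \<comment> \<open>With the old \<open>x k\<close> in place of the new one this combination would
    be the extrapolated point; hence \<open>v - ?z\<close> is the fraction \<open>t\<close> of the
    step in \<open>x\<close>.\<close>
  define v where "v = (1 - t) *\<^sub>R y k + t *\<^sub>R ?x"
  have "?A *\<^sub>R (v - ?z) = ((1 - t) * ?A) *\<^sub>R y k + (t * ?A) *\<^sub>R ?x - ?A *\<^sub>R ?z"
    unfolding v_def by (simp add: scaleR_diff_right scaleR_add_right mult.commute)
  also have "\<dots> = a k *\<^sub>R (?x - x k)"
    unfolding t xt_eq by (simp add: scaleR_diff_right)
  finally have "?A * norm (v - ?z) = a k * norm (?x - x k)"
    using A0 a_pos[of k] by (metis abs_of_pos norm_scaleR)
  then have "?A\<^sup>2 * (norm (v - ?z))\<^sup>2 = (a k)\<^sup>2 * (norm (?x - x k))\<^sup>2"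
    by (metis power_mult_distrib)
  then have "L * ?A\<^sup>2 * (norm (v - ?z))\<^sup>2 = (L * (a k)\<^sup>2) * (norm (?x - x k))\<^sup>2" by simp
  also have "\<dots> = ?A * (?s * (norm (?x - x k))\<^sup>2)" unfolding a_square A_Suc by simp
  finally have "?A * (L * ?A * (norm (v - ?z))\<^sup>2) = ?A * (?s * (norm (?x - x k))\<^sup>2)"
    by (simp only: power2_eq_square[of "A (Suc k)"] mult_ac)
  then have "L * ?A * (norm (v - ?z))\<^sup>2 = ?s * (norm (?x - x k))\<^sup>2"
    using A0 by simp
  then have quad: "?s / 2 * (norm (?x - x k))\<^sup>2 = ?A * (L / 2 * (norm (v - ?z))\<^sup>2)"
    by (simp add: mult.commute mult.left_commute)
  have convex: "?A * \<gamma> k v \<le> A k * \<gamma> k (y k) + a k * \<gamma> k ?x"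
  proof -
    have "\<gamma> k v = (1 - t) * \<gamma> k (y k) + t * \<gamma> k ?x - \<mu> / 2 * (t * (1 - t) * (norm (?x - y k))\<^sup>2)"
      unfolding v_def \<gamma>_def norm_convex_comb_sq
      by (simp add: algebra_simps inner_add_right inner_diff_right add_divide_distrib diff_divide_distrib)
    moreover have "\<mu> / 2 * (t * (1 - t) * (norm (?x - y k))\<^sup>2) \<ge> 0"
      using \<mu> t by simp
    ultimately have "\<gamma> k v \<le> (1 - t) * \<gamma> k (y k) + t * \<gamma> k ?x" by simp
    then have "?A * \<gamma> k v \<le> ?A * ((1 - t) * \<gamma> k (y k) + t * \<gamma> k ?x)"
      using A0 by simp
    also have "\<dots> = ((1 - t) * ?A) * \<gamma> k (y k) + (t * ?A) * \<gamma> k ?x" by (simp add: algebra_simps)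
    finally show ?thesis unfolding t .
  qed
  \<comment> \<open>Expanding around \<open>?y\<close> turns
    \<open>\<gamma> k v + L / 2 |v - ?z|^2\<close> into \<open>q k ?y + L / 2 |?y - ?z|^2\<close>
    plus nonnegative squares, and \<open>upper\<close> applies to that.\<close>
  note norm_sq_three_points[of L v ?z ?y]
  moreover have "L / 2 * (norm (v - ?y))\<^sup>2 \<ge> 0" "\<mu> / 2 * (norm (v - ?y))\<^sup>2 \<ge> 0"
    "\<mu> / 2 * (norm (?y - ?z))\<^sup>2 \<ge> 0" using L \<mu> by auto
  ultimately have "\<psi> ?y \<le> \<gamma> k v + L / 2 * (norm (v - ?z))\<^sup>2"
    using upper[OF zD y_Suc_in[of k]] unfolding \<psi>_def \<gamma>_def q_def by linarith
  then have "?A * \<psi> ?y \<le> ?A * (\<gamma> k v + L / 2 * (norm (v - ?z))\<^sup>2)" using A0 by simp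
  also have "\<dots> \<le> A k * \<gamma> k (y k) + a k * \<gamma> k ?x + ?s / 2 * (norm (?x - x k))\<^sup>2"
    using convex quad by (simp add: distrib_left)
  also have "A k * \<gamma> k (y k) \<le> A k * \<psi> (y k)"
    using \<gamma>_le_q[OF y_in, of k k] q_le_\<psi>[OF zD y_in, of k] A_nonneg[of k] by (intro mult_left_mono) auto
  also note IH
  also have "c k + a k * \<gamma> k ?x + ?s / 2 * (norm (?x - x k))\<^sup>2 = c (Suc k)"
    using \<Gamma>_quadratic[of k ?x] unfolding c_def[of "Suc k"] \<Gamma>_Suc by simp
  finally show ?case by simp
qed

section \<open>Error certificates \<open>r k\<close> and \<open>\<eta> k\<close>\<close>

lemma A_r:
  assumes "k \<ge> 1"
  shows "A k *\<^sub>R r k = x0 - x k"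
  using A_pos[OF assms] unfolding acg_r_def by simp

text \<open>Since \<open>x k\<close> minimizes \<open>A k * \<Gamma> k u + |u - x0|^2 / 2\<close>,
  the gradient of \<open>\<Gamma> k\<close> at \<open>x k\<close> must be
  \<open>(x0 - x k) / A k\<close>, which is \<open>r k\<close>.\<close>

lemma \<Gamma>_affine:
  assumes "k \<ge> 1"
  shows "\<Gamma> k u = \<Gamma> k (x k) + r k \<bullet> (u - x k) + \<mu> / 2 * (norm (u - x k))\<^sup>2"
proof -
  have "A k * \<Gamma> k u = A k * \<Gamma> k (x k) + \<mu> * A k / 2 * (norm (u - x k))\<^sup>2 + (x0 - x k) \<bullet> (u - x k)"
    using \<Gamma>_quadratic[of k u] norm_sq_three_points[of 1 u x0 "x k"]
    unfolding c_def add_divide_distrib distrib_right by linarith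
  also have "\<dots> = A k * (\<Gamma> k (x k) + r k \<bullet> (u - x k) + \<mu> / 2 * (norm (u - x k))\<^sup>2)"
    unfolding A_r[OF assms, symmetric] by (simp add: distrib_left)
  finally show ?thesis using A_pos[OF assms] by simp
qed

text \<open>\<open>\<Gamma> k\<close> minorizes \<open>\<psi>\<close>, and \<open>\<eta> k\<close>
  is the gap at \<open>y k\<close> between \<open>\<psi>\<close> and the linear part of
  \<open>\<Gamma> k\<close>. So \<open>r k\<close> is an \<open>\<eta> k\<close>-subgradient at
  \<open>y k\<close>; the curvature of \<open>\<Gamma> k\<close> remains as a bonus centred at
  \<open>x k\<close>.\<close>

lemma subgradient:
  assumes "valid k" "k \<ge> 1" "u \<in> X"
  shows "\<psi> u \<ge> \<psi> (y k) + r k \<bullet> (u - y k) - \<eta> k + \<mu> / 2 * (norm (u - x k))\<^sup>2"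
proof -
  have "\<Gamma> k u \<le> \<psi> u" using \<Gamma>_le_\<psi>[OF assms(1,3)] A_pos[OF assms(2)] by simp
  moreover have "r k \<bullet> (u - x k) = r k \<bullet> (u - y k) + r k \<bullet> (y k - x k)"
    by (simp add: inner_diff_right)
  ultimately show ?thesis
    using \<Gamma>_affine[OF assms(2), of u] unfolding acg_eta_def \<psi>_def H_def by linarith
qed

lemma \<eta>_bound:
  assumes "valid k" "k \<ge> 1"
  shows "A k * \<eta> k + (norm (y k - x k))\<^sup>2 / 2 \<le> (norm (y k - x0))\<^sup>2 / 2"
proof -
  have "A k * \<eta> k = A k * \<psi> (y k) - A k * \<Gamma> k (x k) - (x0 - x k) \<bullet> (y k - x k)"
    unfolding acg_eta_def \<psi>_def H_def A_r[OF assms(2), symmetric] by (simp add: algebra_simps)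
  then show ?thesis
    using \<psi>_y_le[OF assms(1)] norm_sq_three_points[of 1 "y k" x0 "x k"] unfolding c_def by simp
qed

lemma \<eta>_nonneg:
  assumes "valid k" "k \<ge> 1"
  shows "\<eta> k \<ge> 0"
proof -
  have "\<mu> / 2 * (norm (y k - x k))\<^sup>2 \<ge> 0" using \<mu> by simp
  then show ?thesis using subgradient[OF assms y_in[of k]] by simp
qed

lemma \<eta>_le:
  assumes "valid k" "k \<ge> 1"
  shows "\<eta> k \<le> (norm (x0 - y k))\<^sup>2 / (2 * A k)"
proof -
  have "A k * \<eta> k \<le> (norm (x0 - y k))\<^sup>2 / 2"
    using \<eta>_bound[OF assms] zero_le_power2[of "norm (y k - x k)"]
    unfolding norm_minus_commute[of x0] by linarith
  then show ?thesis using A_pos[OF assms(2)] by (simp add: field_simps)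
qed

lemma norm_y_x_le:
  assumes "valid k" "k \<ge> 1"
  shows "norm (y k - x k) \<le> norm (x0 - y k)"
proof -
  have "A k * \<eta> k \<ge> 0" using \<eta>_nonneg[OF assms] A_nonneg by simp
  then have "(norm (y k - x k))\<^sup>2 \<le> (norm (x0 - y k))\<^sup>2"
    using \<eta>_bound[OF assms] unfolding norm_minus_commute[of x0] by linarith
  then show ?thesis by (simp add: power2_le_iff_abs_le)
qed

lemma norm_r_le:
  assumes "valid k" "k \<ge> 1"
  shows "A k * norm (r k) \<le> 2 * norm (x0 - y k)"
proof -
  have "A k * norm (r k) = norm (x0 - x k)"
    using A_r[OF assms(2)] A_pos[OF assms(2)] by (metis abs_of_pos norm_scaleR)
  also have "\<dots> \<le> norm (x0 - y k) + norm (y k - x k)"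
    using norm_triangle_ineq[of "x0 - y k" "y k - x k"] by simp
  finally show ?thesis using norm_y_x_le[OF assms] by simp
qed

lemma \<psi>_y_gap:
  assumes "valid k" "u \<in> X"
  shows "A k * \<psi> (y k) + (1 + \<mu> * A k) / 2 * (norm (u - x k))\<^sup>2 \<le> A k * \<psi> u + (norm (u - x0))\<^sup>2 / 2"
  using \<psi>_y_le[OF assms(1)] \<Gamma>_quadratic[of k u] \<Gamma>_le_\<psi>[OF assms] by linarith

text \<open>Because of \<open>L a\<^sub>k\<^sup>2 = (1 + \<mu> A\<^sub>k) A\<^bsub>k+1\<^esub>\<close> the coefficient of \<open>x\<^sub>k\<close> cancels; hence every \<open>y\<^sub>k\<close> is a
  convex combination of \<open>x\<^sub>0, \<dots>, x\<^sub>k\<close>.\<close>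

lemma y_Suc_conv:
  "(1 + \<mu> / L) *\<^sub>R y (Suc k) = (A k / A (Suc k)) *\<^sub>R y k + (a k / A (Suc k) + \<mu> / L) *\<^sub>R x (Suc k)"
proof -
  let ?A = "A (Suc k)" and ?s = "1 + \<mu> * A k" and ?y = "y (Suc k)" and ?x = "x (Suc k)"
  have A0: "?A > 0" by (rule A_Suc_pos)
  have s0: "?s > 0" using \<mu> A_nonneg[of k] by (simp add: add_pos_nonneg)
  have sq: "(a k)\<^sup>2 = ?s * ?A / L" using a_square[of k] L unfolding A_Suc by (simp add: field_simps)
  have "a k * (1 + \<mu> * ?A) = a k * ?s + \<mu> * (a k)\<^sup>2"
    unfolding A_Suc by (simp add: algebra_simps power2_eq_square)
  also have "\<dots> = ?s * (a k + \<mu> / L * ?A)" unfolding sq by (simp add: algebra_simps)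
  finally have co: "a k * (1 + \<mu> * ?A) = ?s * (a k + \<mu> / L * ?A)" .
  have "(?s * (a k + \<mu> / L * ?A)) *\<^sub>R (?x - x k) = a k *\<^sub>R (1 + \<mu> * ?A) *\<^sub>R (?x - x k)"
    unfolding co[symmetric] by simp
  also have "\<dots> = (L * (a k)\<^sup>2) *\<^sub>R (?y - xt k) + (\<mu> * (a k)\<^sup>2) *\<^sub>R (?y - x k)"
    unfolding x_Suc by (simp add: scaleR_add_right power2_eq_square mult.commute mult.left_commute)
  also have "\<dots> = ?s *\<^sub>R (?A *\<^sub>R ?y - ?A *\<^sub>R xt k + (\<mu> / L * ?A) *\<^sub>R (?y - x k))"
    unfolding sq using L by (simp add: scaleR_add_right scaleR_diff_right mult_ac)
  finally have "?s *\<^sub>R ((a k + \<mu> / L * ?A) *\<^sub>R (?x - x k))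
      = ?s *\<^sub>R (?A *\<^sub>R ?y - ?A *\<^sub>R xt k + (\<mu> / L * ?A) *\<^sub>R (?y - x k))" by simp
  then have "(a k + \<mu> / L * ?A) *\<^sub>R (?x - x k) = ?A *\<^sub>R ?y - ?A *\<^sub>R xt k + (\<mu> / L * ?A) *\<^sub>R (?y - x k)"
    by (rule scaleR_left_imp_eq[OF less_imp_neq[OF s0, symmetric]])
  then have "?A *\<^sub>R ((1 + \<mu> / L) *\<^sub>R ?y) = A k *\<^sub>R y k + (a k + \<mu> / L * ?A) *\<^sub>R ?x"
    unfolding xt_eq by (simp add: algebra_simps)
  also have "\<dots> = ?A *\<^sub>R ((A k / ?A) *\<^sub>R y k + (a k / ?A + \<mu> / L) *\<^sub>R ?x)"
    using A0 by (simp add: scaleR_add_right scaleR_add_left distrib_left mult.commute)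
  finally show ?thesis by (rule scaleR_left_imp_eq[OF less_imp_neq[OF A0, symmetric]])
qed

lemma norm_y_le:
  assumes "\<And>i. i \<le> k \<Longrightarrow> norm (x i - v) \<le> d"
  shows "norm (y k - v) \<le> d"
  using assms
proof (induction k)
  case 0
  then show ?case by simp
next
  case (Suc k)
  let ?A = "A (Suc k)" and ?\<alpha> = "1 + \<mu> / L"
  have \<alpha>: "?\<alpha> > 0" using \<mu> L by (simp add: add_pos_pos)
  have w: "A k / ?A \<ge> 0" "a k / ?A + \<mu> / L \<ge> 0" "A k / ?A + (a k / ?A + \<mu> / L) = ?\<alpha>"
    using A_nonneg[of k] A_Suc_pos[of k] a_pos[of k] \<mu> L
    by (auto simp: A_Suc add_divide_distrib[symmetric] intro!: add_nonneg_nonneg)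
  have "?\<alpha> *\<^sub>R (y (Suc k) - v) = (A k / ?A) *\<^sub>R (y k - v) + (a k / ?A + \<mu> / L) *\<^sub>R (x (Suc k) - v)"
    unfolding scaleR_diff_right y_Suc_conv
    unfolding w(3)[symmetric] scaleR_add_left by simp
  then have "?\<alpha> * norm (y (Suc k) - v) \<le> A k / ?A * norm (y k - v) + (a k / ?A + \<mu> / L) * norm (x (Suc k) - v)"
    using \<alpha> w by (metis abs_of_nonneg abs_of_pos norm_scaleR norm_triangle_ineq)
  also have "\<dots> \<le> A k / ?A * d + (a k / ?A + \<mu> / L) * d"
    using Suc w by (intro add_mono mult_left_mono) auto
  also have "\<dots> = ?\<alpha> * d" unfolding w(3)[symmetric] by (simp add: distrib_right)
  finally show ?case using \<alpha> by simp
qed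

text \<open>With \<open>d = |x0 - y k|\<close>, \<open>A k \<ge> 8\<close> gives
  \<open>|r k| \<le> d / 4\<close> and \<open>\<eta> k \<le> d^2 / 16\<close>. The left side of the
  test is then at most \<open>3 / 16 d^2\<close>, the right side at least
  \<open>9 / 32 d^2\<close>.\<close>

lemma rel_err:
  assumes "valid k" "k \<ge> 1" "A k \<ge> 8"
  shows "acg_rel_err \<psi>s \<psi>n x0 (1/2) (S k)"
proof -
  define d where "d = norm (x0 - y k)"
  have d: "d \<ge> 0" unfolding d_def by simp
  have "8 * norm (r k) \<le> A k * norm (r k)" using assms(3) by (intro mult_right_mono) auto
  then have r: "norm (r k) \<le> d / 4" using norm_r_le[OF assms(1,2)] unfolding d_def by simp
  have "\<eta> k \<le> d\<^sup>2 / (2 * A k)" unfolding d_def by (rule \<eta>_le[OF assms(1,2)])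
  also have "\<dots> \<le> d\<^sup>2 / 16" using assms(3) by (intro divide_left_mono) auto
  finally have \<eta>: "\<eta> k \<le> d\<^sup>2 / 16" .
  have "norm (x0 - y k + r k) \<ge> d - norm (r k)"
    using norm_triangle_ineq4[of "x0 - y k + r k" "r k"] unfolding d_def by simp
  then have "3 / 4 * d \<le> norm (x0 - y k + r k)" using r by simp
  then have "(3 / 4 * d)\<^sup>2 \<le> (norm (x0 - y k + r k))\<^sup>2" using d by (intro power_mono) auto
  then have "9 / 16 * d\<^sup>2 \<le> (norm (x0 - y k + r k))\<^sup>2" by (simp add: power_divide power_mult_distrib)
  moreover have "(norm (r k))\<^sup>2 \<le> (d / 4)\<^sup>2" using r by (intro power_mono) auto
  then have "(norm (r k))\<^sup>2 \<le> d\<^sup>2 / 16" by (simp add: power_divide)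
  ultimately show ?thesis
    unfolding acg_rel_err_def using \<eta> zero_le_power2[of d] by linarith
qed

lemma valid_mono: "valid k \<Longrightarrow> i \<le> k \<Longrightarrow> valid i"
  unfolding valid_def by auto

end

text \<open>The iterates with \<open>A\<^sub>j \<ge> 18 = 9 / \<mu>\<close> are almost minimizers on the scale of \<open>x\<^sub>0 - y\<^sub>j\<close>. They take the
  place of the exact minimizer, with respect to which the iterates stay in a ball.\<close>

locale acg_half = acg +
  fixes j :: nat
  assumes half: "\<mu> = 1 / 2" and j: "valid j" "j \<ge> 1" "A j \<ge> 18"
begin

lemma \<mu>_mult: "\<mu> * t = t / 2" and \<mu>_half_mult: "\<mu> / 2 * t = t / 4"
  by (simp_all add: half)

definition d :: real where "d = norm (x0 - y j)"

lemma d_nonneg: "d \<ge> 0"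
  unfolding d_def by simp

lemma norm_r_j: "norm (r j) \<le> d / 9"
proof -
  have "18 * norm (r j) \<le> A j * norm (r j)" using j by (intro mult_right_mono) auto
  then show ?thesis using norm_r_le[OF j(1,2)] unfolding d_def by simp
qed

text \<open>The curvature term at \<open>x j\<close> absorbs the linear term of \<open>r j\<close>
  by completing the square. The losses \<open>d^2 / 81\<close>, \<open>d^2 / 9\<close> and
  \<open>d^2 / 36\<close> stay below \<open>d^2 / 4\<close>, the value that \<open>norm_x_le\<close>
  can afford.\<close>

lemma \<psi>_almost_min:
  assumes u: "u \<in> X"
  shows "\<psi> u \<ge> \<psi> (y j) - d\<^sup>2 / 4"
proof -
  let ?R = "norm (r j)" and ?t = "norm (u - x j)"
  have "\<eta> j \<le> d\<^sup>2 / (2 * A j)" unfolding d_def by (rule \<eta>_le[OF j(1,2)])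
  also have "\<dots> \<le> d\<^sup>2 / 36" using j by (intro divide_left_mono) auto
  finally have \<eta>: "\<eta> j \<le> d\<^sup>2 / 36" .
  have "r j \<bullet> (u - y j) = r j \<bullet> (u - x j) - r j \<bullet> (y j - x j)" by (simp add: inner_diff_right)
  moreover have "r j \<bullet> (u - x j) \<ge> - (?R * ?t)"
    using Cauchy_Schwarz_ineq2[of "r j" "u - x j"] by linarith
  moreover have "r j \<bullet> (y j - x j) \<le> ?R * norm (y j - x j)"
    using Cauchy_Schwarz_ineq2[of "r j" "y j - x j"] by linarith
  moreover have "?R * norm (y j - x j) \<le> d / 9 * d"
    using norm_r_j norm_y_x_le[OF j(1,2)] d_nonneg by (intro mult_mono) (auto simp: d_def)
  moreover have "?t\<^sup>2 / 4 - ?R * ?t \<ge> - ?R\<^sup>2"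
    using zero_le_power2[of "?t / 2 - ?R"] by (simp add: power2_eq_square algebra_simps)
  moreover have "?R\<^sup>2 \<le> (d / 9)\<^sup>2" using norm_r_j by (intro power_mono) auto
  ultimately have "r j \<bullet> (u - y j) + ?t\<^sup>2 / 4 \<ge> - (d / 9)\<^sup>2 - d / 9 * d" by linarith
  moreover have "- (d / 9)\<^sup>2 - d / 9 * d - d\<^sup>2 / 36 \<ge> - d\<^sup>2 / 4"
    by (simp add: power2_eq_square)
  ultimately show ?thesis using subgradient[OF j(1,2) u] \<eta> unfolding \<mu>_half_mult by linarith
qed

text \<open>In \<open>\<psi>_y_gap\<close> with \<open>u = y j\<close> the deficit
  \<open>A k * d^2 / 4\<close> and the start term \<open>d^2 / 2\<close> add up to
  \<open>d^2\<close> times the coefficient of \<open>|y j - x k|^2\<close>, so the radius does not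
  depend on \<open>k\<close>.\<close>

lemma norm_x_le:
  assumes "valid k"
  shows "norm (x k - y j) \<le> d"
proof -
  have "A k * (\<psi> (y j) - d\<^sup>2 / 4) \<le> A k * \<psi> (y k)"
    using \<psi>_almost_min[OF y_in] A_nonneg by (intro mult_left_mono) auto
  moreover have "A k * \<psi> (y k) + (1 + A k / 2) / 2 * (norm (y j - x k))\<^sup>2 \<le> A k * \<psi> (y j) + d\<^sup>2 / 2"
    using \<psi>_y_gap[OF assms y_in[of j]] unfolding \<mu>_mult d_def norm_minus_commute[of x0] by simp
  moreover have "(1 + A k / 2) / 2 * d\<^sup>2 = A k * (d\<^sup>2 / 4) + d\<^sup>2 / 2" by (simp add: field_simps)
  ultimately have "(1 + A k / 2) / 2 * (norm (y j - x k))\<^sup>2 \<le> (1 + A k / 2) / 2 * d\<^sup>2"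
    unfolding right_diff_distrib by linarith
  moreover have "(1 + A k / 2) / 2 > 0" using A_nonneg[of k] by simp
  ultimately have "(norm (y j - x k))\<^sup>2 \<le> d\<^sup>2" by (simp only: mult_le_cancel_left_pos)
  then show ?thesis using d_nonneg by (simp add: norm_minus_commute power2_le_iff_abs_le)
qed

lemma norm_y_le_d: "valid k \<Longrightarrow> norm (y k - y j) \<le> d"
  using norm_y_le norm_x_le valid_mono by blast

lemma norm_x0_y_le: "valid k \<Longrightarrow> norm (x0 - y k) \<le> 2 * d"
  using norm_triangle_ineq4[of "x0 - y j" "y k - y j"] norm_y_le_d[of k] unfolding d_def by simp

lemma d_le: "d \<le> 9 / 8 * norm (x0 - y j + r j)"
  using norm_triangle_ineq4[of "x0 - y j + r j" "r j"] norm_r_j unfolding d_def by simp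

text \<open>The residual is compared with \<open>x0 - y j\<close>: the difference is
  \<open>r k - ?p\<close>. Near-minimality of \<open>y j\<close> bounds
  \<open>r k \<bullet> ?p\<close> from below, and the relative error test removes \<open>r k\<close>
  and \<open>\<eta> k\<close>.\<close>

lemma residual_le:
  assumes k: "valid k" "k \<ge> 1" and err: "acg_rel_err \<psi>s \<psi>n x0 (1/2) (S k)"
  shows "norm (x0 - y k + r k) \<le> 5 * norm (x0 - y j + r j)"
proof -
  let ?w = "x0 - y k + r k" and ?p = "y k - y j"
  have sub: "r k \<bullet> ?p \<ge> - d\<^sup>2 / 4 - \<eta> k"
  proof -
    have "\<mu> / 2 * (norm (y j - x k))\<^sup>2 \<ge> 0" using \<mu> by simp
    moreover have "r k \<bullet> (y j - y k) = - (r k \<bullet> ?p)" by (simp add: inner_diff_right)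
    ultimately show ?thesis
      using subgradient[OF k y_in[of j]] \<psi>_almost_min[OF y_in[of k]] by linarith
  qed
  have "(norm ?w - d)\<^sup>2 \<le> (norm (?w - (x0 - y j)))\<^sup>2"
    unfolding d_def using norm_triangle_ineq3[of ?w "x0 - y j"] by (metis abs_ge_zero power2_abs power_mono)
  also have "?w - (x0 - y j) = r k - ?p" by simp
  also have "(norm (r k - ?p))\<^sup>2 = (norm (r k))\<^sup>2 + (norm ?p)\<^sup>2 - 2 * (r k \<bullet> ?p)"
    unfolding power2_norm_eq_inner by (simp add: algebra_simps inner_commute)
  also have "\<dots> \<le> (norm ?w)\<^sup>2 / 2 + 3 / 2 * d\<^sup>2"
  proof -
    have "(norm (r k))\<^sup>2 + 2 * \<eta> k \<le> (norm ?w)\<^sup>2 / 2" using err unfolding acg_rel_err_def by simp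
    moreover have "(norm ?p)\<^sup>2 \<le> d\<^sup>2" using norm_y_le_d[OF k(1)] by (intro power_mono) auto
    ultimately show ?thesis using sub by simp
  qed
  finally have *: "norm ?w * (norm ?w - 4 * d) \<le> d\<^sup>2" by (simp add: power2_eq_square algebra_simps)
  \<comment> \<open>The positive root of \<open>t (t - 4 d) = d^2\<close> is
    \<open>(2 + sqrt 5) d\<close>, just below \<open>17 / 4 * d\<close>; and
    \<open>17 / 4 * 9 / 8 < 5\<close>.\<close>
  have "norm ?w \<le> 17 / 4 * d"
  proof (rule ccontr)
    assume "\<not> ?thesis"
    then have "norm ?w > 17 / 4 * d" by simp
    then have "17 / 4 * d * (1 / 4 * d) < norm ?w * (norm ?w - 4 * d)"
      using d_nonneg by (intro mult_strict_mono') auto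
    moreover have "17 / 4 * d * (1 / 4 * d) = 17 / 16 * d\<^sup>2" by (simp add: power2_eq_square)
    ultimately show False using * zero_le_power2[of d] by linarith
  qed
  also have "\<dots> \<le> 5 * norm (x0 - y j + r j)" using d_le norm_ge_zero[of "x0 - y j + r j"] by linarith
  finally show ?thesis .
qed

lemma \<eta>_le_residual:
  assumes k: "valid k" "k \<ge> 1"
  shows "\<eta> k \<le> 81 / 32 * (norm (x0 - y j + r j))\<^sup>2 / A k"
proof -
  have "(norm (x0 - y k))\<^sup>2 \<le> (9 / 4 * norm (x0 - y j + r j))\<^sup>2"
    using norm_x0_y_le[OF k(1)] d_le by (intro power_mono) auto
  then have "(norm (x0 - y k))\<^sup>2 / (2 * A k) \<le> (9 / 4 * norm (x0 - y j + r j))\<^sup>2 / (2 * A k)"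
    using A_nonneg[of k] by (intro divide_right_mono) auto
  then show ?thesis using \<eta>_le[OF k] by (simp add: power_mult_distrib power_divide)
qed

end

section \<open>The smoothed max function\<close>

lemma GDERIV_unique:
  assumes "GDERIV f x :> D" "GDERIV f x :> D'"
  shows "D = D'"
proof -
  have "(\<lambda>h. h \<bullet> D) = (\<lambda>h. h \<bullet> D')"
    using assms unfolding gderiv_def by (rule has_derivative_unique)
  then have "(D - D') \<bullet> D = (D - D') \<bullet> D'" by metis
  then have "(D - D') \<bullet> (D - D') = 0" by (simp add: inner_diff_right)
  then show ?thesis by simp
qed

lemma grad_eqI: "GDERIV f x :> D \<Longrightarrow> grad f x = D"
  unfolding grad_def by (rule the_equality) (auto dest: GDERIV_unique)

text \<open>\<open>D\<close> carries the curvature bounds to gradient evaluations outside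
  \<open>X\<close>. Its convexity keeps in \<open>D\<close> the segments along which the upper bound
  for \<open>f\<close> is proved.\<close>

locale saddle = minmax X Y \<Omega> \<Phi> h m Lx Ly + aipp_s Y \<Phi> h m Lx Ly y0 \<xi> \<rho>
  for X D :: "'a::euclidean_space set" and Y :: "'b::euclidean_space set" and \<Omega> \<Phi> h m Lx Ly y0 \<xi> \<rho> +
  assumes y0: "y0 \<in> Y" and \<xi>: "\<xi> > 0"
    and D: "convex D" "X \<subseteq> D" "D \<subseteq> \<Omega>" and D_curvature: "curvature_on D Y \<Phi> m Lx Ly"
begin

abbreviation \<Psi> :: "'a \<Rightarrow> 'b \<Rightarrow> real" where
  "\<Psi> x y \<equiv> \<Phi> x y - 1 / (2 * \<xi>) * (norm (y - y0))\<^sup>2"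

lemma GDERIV_grad_x:
  assumes "x \<in> \<Omega>" "y \<in> Y"
  shows "GDERIV (\<lambda>x'. \<Phi> x' y) x :> grad_x \<Phi> x y"
  using Phi_diff[OF assms] unfolding grad_x_def by (auto dest: grad_eqI)

lemma \<Phi>_continuous:
  assumes "x \<in> \<Omega>"
  shows "continuous_on Y (\<Phi> x)"
proof -
  have "continuous_on Y (\<lambda>y. case (x, y) of (x, y) \<Rightarrow> \<Phi> x y)"
    by (rule continuous_on_compose2[OF Phi_cont]) (use assms in \<open>auto intro!: continuous_intros\<close>)
  then show ?thesis by simp
qed

text \<open>\<open>\<Psi> x\<close> is strongly concave in \<open>y\<close> with modulus
  \<open>1 / \<xi>\<close>. The quadratic growth behind its maximum yields the subgradient
  \<open>vbar\<close> as well as continuity and the Lipschitz bound of \<open>y_xi\<close>.\<close>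

lemma
  assumes x: "x \<in> \<Omega>"
  shows y_xi_in: "y_xi x \<in> Y"
    and y_xi_max: "y \<in> Y \<Longrightarrow> \<Psi> x y + 1 / (2 * \<xi>) * (norm (y - y_xi x))\<^sup>2 \<le> \<Psi> x (y_xi x)"
proof -
  have "continuous_on Y (\<Psi> x)"
    by (intro continuous_intros \<Phi>_continuous[OF x])
  then obtain y' where "y' \<in> Y" "\<forall>y\<in>Y. \<Psi> x y \<le> \<Psi> x y'"
    using continuous_attains_sup Y by blast
  then have "is_arg_max (\<Psi> x) (\<lambda>y. y \<in> Y) y'" unfolding is_arg_max_def by (auto simp: not_less)
  then have "is_arg_max (\<Psi> x) (\<lambda>y. y \<in> Y) (y_xi x)"
    unfolding y_xi_def arg_max_def by (rule someI)
  then have *: "y_xi x \<in> Y" "\<And>y. y \<in> Y \<Longrightarrow> \<Psi> x y \<le> \<Psi> x (y_xi x)"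
    unfolding is_arg_max_def by (auto simp: not_less)
  show "y_xi x \<in> Y" by (rule *)
  have "convex_on Y (\<lambda>y. real_of_ereal (neg_ext Y (\<Phi> x) y))"
    by (rule closed_conv_convex_on[OF Phi_conc[OF x]])
  then have cv: "convex_on Y (\<lambda>y. - \<Phi> x y)"
    unfolding convex_on_def neg_ext_def by (auto simp: convex_def)
  assume y: "y \<in> Y"
  have half: "1 / \<xi> / 2 = 1 / (2 * \<xi>)" by simp
  have "- \<Phi> x (y_xi x) + 0 \<bullet> (y_xi x - y0) + 1 / \<xi> / 2 * (norm (y_xi x - y0))\<^sup>2 + 1 / \<xi> / 2 * (norm (y - y_xi x))\<^sup>2
           \<le> - \<Phi> x y + 0 \<bullet> (y - y0) + 1 / \<xi> / 2 * (norm (y - y0))\<^sup>2"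
    by (rule strongly_convex_min[OF cv *(1) y]) (use *(2) in \<open>force simp: half\<close>)
  then show "\<Psi> x y + 1 / (2 * \<xi>) * (norm (y - y_xi x))\<^sup>2 \<le> \<Psi> x (y_xi x)"
    unfolding half by simp
qed

lemma \<Psi>_le: "x \<in> \<Omega> \<Longrightarrow> y \<in> Y \<Longrightarrow> \<Psi> x y \<le> \<Psi> x (y_xi x)"
  using y_xi_max[of x y] \<xi> by (smt (verit) divide_nonneg_pos mult_nonneg_nonneg zero_le_power2)

lemma f_eq: "x \<in> \<Omega> \<Longrightarrow> f x = \<Psi> x (y_xi x)"
  unfolding f_def by (rule cSup_eq_maximum) (use y_xi_in \<Psi>_le in auto)

lemma f_ge: "x \<in> \<Omega> \<Longrightarrow> y \<in> Y \<Longrightarrow> \<Psi> x y \<le> f x"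
  using \<Psi>_le f_eq by simp

text \<open>Expanding \<open>|u - y0|^2\<close> around \<open>y_xi x\<close> leaves a square that
  the quadratic growth at the maximizer cancels exactly.\<close>

lemma vbar_subdiff:
  assumes x: "x \<in> \<Omega>"
  shows "(1 / \<xi>) *\<^sub>R (y0 - y_xi x) \<in> subdiff (neg_ext Y (\<Phi> x)) (y_xi x)"
  unfolding subdiff_def
proof (intro CollectI allI)
  fix u
  show "neg_ext Y (\<Phi> x) (y_xi x) + ereal ((1 / \<xi>) *\<^sub>R (y0 - y_xi x) \<bullet> (u - y_xi x)) \<le> neg_ext Y (\<Phi> x) u"
  proof (cases "u \<in> Y")
    case True
    have "1 / \<xi> / 2 * (norm (u - y0))\<^sup>2 = 1 / \<xi> / 2 * (norm (u - y_xi x))\<^sup>2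
       - 1 / \<xi> * ((y0 - y_xi x) \<bullet> (u - y_xi x)) + 1 / \<xi> / 2 * (norm (y_xi x - y0))\<^sup>2"
      by (rule norm_sq_three_points)
    then have "- \<Phi> x (y_xi x) + 1 / \<xi> * ((y0 - y_xi x) \<bullet> (u - y_xi x)) \<le> - \<Phi> x u"
      using y_xi_max[OF x True] by simp
    then show ?thesis using True y_xi_in[OF x] unfolding neg_ext_def by simp
  qed (simp add: neg_ext_def)
qed

lemma norm_vbar:
  assumes "x \<in> \<Omega>" "\<xi> \<ge> diameter Y / \<rho>y" "\<rho>y > 0"
  shows "norm ((1 / \<xi>) *\<^sub>R (y0 - y_xi x)) \<le> \<rho>y"
proof -
  have "norm (y0 - y_xi x) \<le> diameter Y"
    using diameter_bounded_bound[OF compact_imp_bounded[OF Y(3)] y0 y_xi_in[OF assms(1)]] by (simp add: dist_norm)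
  also have "\<dots> \<le> \<xi> * \<rho>y" using assms by (simp add: field_simps)
  finally have "1 / \<xi> * norm (y0 - y_xi x) \<le> \<rho>y" using \<xi> by (simp add: field_simps)
  then show ?thesis using \<xi> by (simp only: norm_scaleR) simp
qed

lemma p_max_bounds:
  assumes x: "x \<in> \<Omega>"
  shows "f x \<le> p_max Y \<Phi> x" "p_max Y \<Phi> x \<le> f x + (diameter Y)\<^sup>2 / (2 * \<xi>)"
proof -
  have bdd: "bdd_above (\<Phi> x ` Y)"
    by (intro bounded_imp_bdd_above compact_imp_bounded compact_continuous_image \<Phi>_continuous x Y)
  have "f x \<le> \<Phi> x (y_xi x)" unfolding f_eq[OF x] using \<xi> by simp
  also have "\<dots> \<le> p_max Y \<Phi> x" unfolding p_max_def by (rule cSUP_upper[OF y_xi_in[OF x] bdd])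
  finally show "f x \<le> p_max Y \<Phi> x" .
  show "p_max Y \<Phi> x \<le> f x + (diameter Y)\<^sup>2 / (2 * \<xi>)"
    unfolding p_max_def
  proof (rule cSUP_least[OF Y(1)])
    fix y assume y: "y \<in> Y"
    have "norm (y - y0) \<le> diameter Y"
      using diameter_bounded_bound[OF compact_imp_bounded[OF Y(3)] y y0] by (simp add: dist_norm)
    then have "(norm (y - y0))\<^sup>2 / (2 * \<xi>) \<le> (diameter Y)\<^sup>2 / (2 * \<xi>)"
      using \<xi> by (intro divide_right_mono power_mono) auto
    then show "\<Phi> x y \<le> f x + (diameter Y)\<^sup>2 / (2 * \<xi>)" using f_ge[OF x y] by simp
  qed
qed

text \<open>Differentiability needs continuity of \<open>y_xi\<close> on a neighbourhood, whereas
  curvature is known only on \<open>D\<close>. So only the continuity of \<open>\<Phi>\<close>,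
  uniform on a compact set, is used: adding two growth inequalities bounds
  \<open>|y_xi u - y_xi x|^2 / \<xi>\<close> by increments of \<open>\<Phi>\<close>.\<close>

lemma y_xi_near:
  assumes x: "x \<in> \<Omega>" and e: "e > 0"
  shows "\<exists>\<delta>>0. \<forall>u. norm (u - x) < \<delta> \<longrightarrow> u \<in> \<Omega> \<and> norm (y_xi u - y_xi x) < e"
proof -
  obtain \<epsilon> where \<epsilon>: "\<epsilon> > 0" "cball x \<epsilon> \<subseteq> \<Omega>" using Omega(1) x open_contains_cball by blast
  have "continuous_on (cball x \<epsilon> \<times> Y) (\<lambda>(x, y). \<Phi> x y)"
    by (rule continuous_on_subset[OF Phi_cont]) (use \<epsilon> in auto)
  then have "uniformly_continuous_on (cball x \<epsilon> \<times> Y) (\<lambda>(x, y). \<Phi> x y)"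
    by (rule compact_uniformly_continuous) (intro compact_Times compact_cball Y)
  moreover have "e\<^sup>2 / (4 * \<xi>) > 0" using e \<xi> by simp
  ultimately obtain \<delta> where \<delta>: "\<delta> > 0" "\<And>p p'. p \<in> cball x \<epsilon> \<times> Y \<Longrightarrow> p' \<in> cball x \<epsilon> \<times> Y \<Longrightarrow> dist p' p < \<delta>
     \<Longrightarrow> dist (case p' of (x, y) \<Rightarrow> \<Phi> x y) (case p of (x, y) \<Rightarrow> \<Phi> x y) < e\<^sup>2 / (4 * \<xi>)"
    unfolding uniformly_continuous_on_def by metis
  show ?thesis
  proof (intro exI conjI allI impI)
    show "min \<delta> \<epsilon> > 0" using \<delta> \<epsilon> by simp
    fix u assume u: "norm (u - x) < min \<delta> \<epsilon>"
    then have uc: "u \<in> cball x \<epsilon>" by (simp add: dist_norm norm_minus_commute)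
    then show u\<Omega>: "u \<in> \<Omega>" using \<epsilon> by auto
    have close: "\<bar>\<Phi> u y - \<Phi> x y\<bar> < e\<^sup>2 / (4 * \<xi>)" if "y \<in> Y" for y
      using \<delta>(2)[of "(x, y)" "(u, y)"] that u uc \<epsilon> by (auto simp: dist_Pair_Pair dist_norm)
    let ?d = "norm (y_xi u - y_xi x)"
    have "1 / (2 * \<xi>) * ?d\<^sup>2 + 1 / (2 * \<xi>) * ?d\<^sup>2
      \<le> (\<Phi> x (y_xi x) - \<Phi> u (y_xi x)) + (\<Phi> u (y_xi u) - \<Phi> x (y_xi u))"
      using y_xi_max[OF x y_xi_in[OF u\<Omega>]] y_xi_max[OF u\<Omega> y_xi_in[OF x]]
      unfolding norm_minus_commute[of "y_xi x" "y_xi u"] by linarith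
    also have "\<dots> < e\<^sup>2 / (4 * \<xi>) + e\<^sup>2 / (4 * \<xi>)"
      using close[OF y_xi_in[OF x]] close[OF y_xi_in[OF u\<Omega>]] by (intro add_strict_mono) auto
    finally have "?d\<^sup>2 / \<xi> < e\<^sup>2 / (2 * \<xi>)" by simp
    then have "?d\<^sup>2 < e\<^sup>2 / 2" using \<xi> by (simp add: field_simps)
    then have "?d\<^sup>2 < e\<^sup>2" using zero_le_power2[of e] by linarith
    then show "?d < e" using e by (simp add: power_less_imp_less_base)
  qed
qed

text \<open>The increment of \<open>f\<close> lies between those of \<open>\<Phi>\<close> in its
  first argument at \<open>y_xi x\<close> and at \<open>y_xi u\<close>. Both have nearly the same
  linearization, because \<open>y_xi\<close> is continuous and the gradient is jointly
  continuous.\<close>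

lemma Danskin_GDERIV_f:
  assumes x: "x \<in> \<Omega>"
  shows "GDERIV f x :> grad_x \<Phi> x (y_xi x)"
  unfolding gderiv_def has_derivative_at_alt
proof (intro conjI allI impI)
  let ?G = "grad_x \<Phi> x (y_xi x)"
  show "bounded_linear (\<lambda>h. h \<bullet> ?G)" by (rule bounded_linear_inner_left)
  fix e :: real assume e: "e > 0"
  have "(x, y_xi x) \<in> \<Omega> \<times> Y" using x y_xi_in by simp
  then obtain \<delta>1 where \<delta>1: "\<delta>1 > 0" "\<And>p. p \<in> \<Omega> \<times> Y \<Longrightarrow> dist p (x, y_xi x) < \<delta>1 \<Longrightarrow>
      dist (case p of (x, y) \<Rightarrow> grad_x \<Phi> x y) ?G < e"
    using grad_cont[unfolded continuous_on_iff] e by fastforce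
  obtain \<delta>2 where \<delta>2: "\<delta>2 > 0" "\<And>u. norm (u - x) < \<delta>2 \<Longrightarrow> u \<in> \<Omega> \<and> norm (y_xi u - y_xi x) < \<delta>1 / 2"
    using y_xi_near[OF x, of "\<delta>1 / 2"] \<delta>1 by auto
  define \<delta> where "\<delta> = min (\<delta>1 / 2) \<delta>2"
  have \<delta>: "\<delta> > 0" unfolding \<delta>_def using \<delta>1 \<delta>2 by simp
  have lin: "\<bar>\<Phi> u y - \<Phi> x y - (u - x) \<bullet> ?G\<bar> \<le> e * norm (u - x)"
    if u: "norm (u - x) < \<delta>" and y: "y \<in> Y" "norm (y - y_xi x) < \<delta>1 / 2" for u y
  proof -
    have "norm ((\<Phi> u y - u \<bullet> ?G) - (\<Phi> x y - x \<bullet> ?G)) \<le> e * norm (u - x)"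
    proof (rule differentiable_bound[where S = "ball x \<delta>"])
      fix v assume "v \<in> ball x \<delta>"
      then have v: "norm (v - x) < \<delta>" by (simp add: dist_norm norm_minus_commute)
      then have v\<Omega>: "v \<in> \<Omega>" using \<delta>2(2)[of v] unfolding \<delta>_def by simp
      show "((\<lambda>v. \<Phi> v y - v \<bullet> ?G) has_derivative (\<lambda>h. h \<bullet> (grad_x \<Phi> v y - ?G))) (at v within ball x \<delta>)"
      proof -
        have "((\<lambda>v. \<Phi> v y) has_derivative (\<lambda>h. h \<bullet> grad_x \<Phi> v y)) (at v within ball x \<delta>)"
          using GDERIV_grad_x[OF v\<Omega> y(1)] unfolding gderiv_def by (rule has_derivative_at_withinI)
        then show ?thesis unfolding inner_diff_right
          by (intro derivative_intros)
      qed
      have "dist (v, y) (x, y_xi x) \<le> dist v x + dist y (y_xi x)"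
        unfolding dist_Pair_Pair by (rule sqrt_sum_squares_le_sum) auto
      also have "\<dots> < \<delta>1" using v y unfolding \<delta>_def dist_norm by linarith
      finally have "norm (grad_x \<Phi> v y - ?G) < e"
        using \<delta>1(2)[of "(v, y)"] v\<Omega> y by (simp add: dist_norm)
      then show "onorm (\<lambda>h. h \<bullet> (grad_x \<Phi> v y - ?G)) \<le> e"
        by (intro onorm_bound) (use e in \<open>auto intro!: order_trans[OF Cauchy_Schwarz_ineq2]
            simp: mult.commute[of e] mult_left_mono\<close>)
    qed (use u \<delta> in \<open>auto simp: dist_norm norm_minus_commute\<close>)
    then show ?thesis by (simp add: algebra_simps)
  qed
  show "\<exists>d>0. \<forall>u. norm (u - x) < d \<longrightarrow> norm (f u - f x - (u - x) \<bullet> ?G) \<le> e * norm (u - x)"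
  proof (intro exI conjI allI impI)
    fix u assume u: "norm (u - x) < \<delta>"
    then have u': "u \<in> \<Omega>" "norm (y_xi u - y_xi x) < \<delta>1 / 2" using \<delta>2(2)[of u] unfolding \<delta>_def by auto
    have "f u - f x \<le> \<Phi> u (y_xi u) - \<Phi> x (y_xi u)"
      using f_ge[OF x y_xi_in[OF u'(1)]] f_eq[OF u'(1)] by simp
    moreover have "f u - f x \<ge> \<Phi> u (y_xi x) - \<Phi> x (y_xi x)"
      using f_ge[OF u'(1) y_xi_in[OF x]] f_eq[OF x] by simp
    ultimately show "norm (f u - f x - (u - x) \<bullet> ?G) \<le> e * norm (u - x)"
      using lin[OF u y_xi_in[OF u'(1)] u'(2)] lin[OF u y_xi_in[OF x]] \<delta>1(1) by simp
  qed (use \<delta> in simp)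
qed

lemma grad_f: "x \<in> \<Omega> \<Longrightarrow> grad f x = grad_x \<Phi> x (y_xi x)"
  by (rule grad_eqI[OF Danskin_GDERIV_f])

section \<open>Curvature of the smoothed function\<close>

lemma f_lower:
  assumes "u \<in> D" "x \<in> D"
  shows "lin f x u - m / 2 * (norm (u - x))\<^sup>2 \<le> f u"
proof -
  have \<Omega>: "u \<in> \<Omega>" "x \<in> \<Omega>" using assms D by auto
  have "\<Phi> u (y_xi x) - (\<Phi> x (y_xi x) + grad_x \<Phi> x (y_xi x) \<bullet> (u - x)) \<ge> - (m / 2) * (norm (u - x))\<^sup>2"
    using D_curvature assms y_xi_in[OF \<Omega>(2)] unfolding curvature_on_def by blast
  then show ?thesis
    using f_ge[OF \<Omega>(1) y_xi_in[OF \<Omega>(2)]] f_eq[OF \<Omega>(2)] unfolding lin_def grad_f[OF \<Omega>(2)] by simp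
qed

text \<open>Two growth inequalities and two lower curvature bounds give
  \<open>d^2 \<le> \<xi> ((Lx e + Ly d) e + m e^2)\<close> for the displacements \<open>d\<close> of
  \<open>y_xi\<close> and \<open>e\<close> of the point. Solving for \<open>d\<close> produces the
  bracket in the definition of \<open>M\<close>.\<close>

lemma y_xi_Lipschitz:
  assumes "u \<in> D" "x \<in> D"
  shows "norm (y_xi u - y_xi x) \<le> (\<xi> * Ly + sqrt (\<xi> * (Lx + m))) * norm (u - x)"
proof -
  have \<Omega>: "u \<in> \<Omega>" "x \<in> \<Omega>" using assms D by auto
  note yu = y_xi_in[OF \<Omega>(1)] and yx = y_xi_in[OF \<Omega>(2)]
  let ?d = "norm (y_xi u - y_xi x)" and ?e = "norm (u - x)"
  let ?gu = "grad_x \<Phi> u (y_xi u)" and ?gx = "grad_x \<Phi> x (y_xi x)"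
  have "1 / (2 * \<xi>) * ?d\<^sup>2 + 1 / (2 * \<xi>) * ?d\<^sup>2
      \<le> (\<Phi> x (y_xi x) - \<Phi> u (y_xi x)) + (\<Phi> u (y_xi u) - \<Phi> x (y_xi u))"
    using y_xi_max[OF \<Omega>(2) yu] y_xi_max[OF \<Omega>(1) yx]
    unfolding norm_minus_commute[of "y_xi x" "y_xi u"] by linarith
  also have "\<dots> \<le> (?gu - ?gx) \<bullet> (u - x) + m * ?e\<^sup>2"
  proof -
    have "\<Phi> u (y_xi x) - (\<Phi> x (y_xi x) + ?gx \<bullet> (u - x)) \<ge> - (m / 2) * ?e\<^sup>2"
      "\<Phi> x (y_xi u) - (\<Phi> u (y_xi u) + ?gu \<bullet> (x - u)) \<ge> - (m / 2) * (norm (x - u))\<^sup>2"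
      using D_curvature assms yu yx unfolding curvature_on_def by blast+
    then show ?thesis unfolding norm_minus_commute[of x u] by (simp add: inner_diff_left inner_diff_right)
  qed
  also have "(?gu - ?gx) \<bullet> (u - x) \<le> norm (?gu - ?gx) * ?e" by (rule norm_cauchy_schwarz)
  also have "norm (?gu - ?gx) \<le> Lx * ?e + Ly * ?d"
    using D_curvature assms yu yx unfolding curvature_on_def by blast
  finally have "1 / (2 * \<xi>) * ?d\<^sup>2 + 1 / (2 * \<xi>) * ?d\<^sup>2 \<le> (Lx * ?e + Ly * ?d) * ?e + m * ?e\<^sup>2"
    by (simp add: mult_right_mono)
  then have "?d\<^sup>2 \<le> \<xi> * ((Lx * ?e + Ly * ?d) * ?e + m * ?e\<^sup>2)"
    using \<xi> by (simp add: field_simps)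
  then have quad: "?d\<^sup>2 \<le> (\<xi> * Ly * ?e) * ?d + (sqrt (\<xi> * (Lx + m)) * ?e)\<^sup>2"
    using \<xi> parameters by (simp add: power_mult_distrib power2_eq_square algebra_simps)
  show ?thesis
  proof (rule ccontr)
    define b where "b = \<xi> * Ly * ?e"
    define c where "c = sqrt (\<xi> * (Lx + m)) * ?e"
    have bc: "b \<ge> 0" "c \<ge> 0" unfolding b_def c_def using \<xi> parameters by auto
    assume "\<not> ?thesis"
    then have "?d > b + c" unfolding b_def c_def by (simp add: algebra_simps)
    then have "(?d - b) * ?d > c * c" using bc by (intro mult_strict_mono') auto
    then show False using quad unfolding b_def[symmetric] c_def[symmetric]
      by (simp add: power2_eq_square algebra_simps)
  qed
qed

lemma M_pos: "M > 0" and m_le_M: "m \<le> M"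
proof -
  have "M \<ge> Lx" unfolding M_def using \<xi> parameters by simp
  then show "M > 0" "m \<le> M" using parameters by auto
qed

lemma grad_f_Lipschitz:
  assumes "u \<in> D" "x \<in> D"
  shows "norm (grad f u - grad f x) \<le> M * norm (u - x)"
proof -
  have \<Omega>: "u \<in> \<Omega>" "x \<in> \<Omega>" using assms D by auto
  have "norm (grad f u - grad f x) \<le> Lx * norm (u - x) + Ly * norm (y_xi u - y_xi x)"
    unfolding grad_f[OF \<Omega>(1)] grad_f[OF \<Omega>(2)]
    using D_curvature assms y_xi_in[OF \<Omega>(1)] y_xi_in[OF \<Omega>(2)] unfolding curvature_on_def by blast
  also have "\<dots> \<le> Lx * norm (u - x) + Ly * ((\<xi> * Ly + sqrt (\<xi> * (Lx + m))) * norm (u - x))"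
    using y_xi_Lipschitz[OF assms] parameters by (intro add_left_mono mult_left_mono) auto
  also have "\<dots> = M * norm (u - x)" unfolding M_def by (simp add: algebra_simps)
  finally show ?thesis .
qed

lemma f_upper:
  assumes "u \<in> D" "x \<in> D"
  shows "f u \<le> lin f x u + M / 2 * (norm (u - x))\<^sup>2"
proof -
  let ?v = "\<lambda>t. x + t *\<^sub>R (u - x)" and ?d = "u - x"
  let ?g = "\<lambda>t. f (?v t) - t * (grad f x \<bullet> ?d) - M / 2 * t\<^sup>2 * (norm ?d)\<^sup>2"
  have vD: "?v t \<in> D" if "0 \<le> t" "t \<le> 1" for t
    using D(1) assms that unfolding convex_alt by (force simp: algebra_simps)
  have "?g 1 \<le> ?g 0"
  proof (rule DERIV_nonpos_imp_nonincreasing[of 0 1 ?g])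
    fix t :: real assume t: "0 \<le> t" "t \<le> 1"
    have "(f has_derivative (\<lambda>h. h \<bullet> grad f (?v t))) (at (?v t))"
      using Danskin_GDERIV_f[of "?v t"] vD[OF t] D grad_f[of "?v t"] unfolding gderiv_def by auto
    then have "((\<lambda>t. f (?v t)) has_derivative (\<lambda>s. (s *\<^sub>R ?d) \<bullet> grad f (?v t))) (at t)"
      by (rule has_derivative_compose[rotated]) (auto intro!: derivative_eq_intros)
    then have 1: "((\<lambda>t. f (?v t)) has_real_derivative (?d \<bullet> grad f (?v t))) (at t)"
      unfolding has_field_derivative_def by (simp add: mult.commute[of _ "?d \<bullet> _"])
    have "(?g has_real_derivative (?d \<bullet> grad f (?v t) - grad f x \<bullet> ?d - M * t * (norm ?d)\<^sup>2)) (at t)"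
      by (rule derivative_eq_intros 1 refl | simp)+
    moreover have "?d \<bullet> grad f (?v t) - grad f x \<bullet> ?d - M * t * (norm ?d)\<^sup>2 \<le> 0"
    proof -
      have "?d \<bullet> grad f (?v t) - grad f x \<bullet> ?d = (grad f (?v t) - grad f x) \<bullet> ?d"
        by (metis inner_commute inner_diff_left)
      also have "\<dots> \<le> norm (grad f (?v t) - grad f x) * norm ?d" by (rule norm_cauchy_schwarz)
      also have "\<dots> \<le> (M * norm (?v t - x)) * norm ?d"
        by (intro mult_right_mono grad_f_Lipschitz vD t assms) auto
      also have "\<dots> = M * t * (norm ?d)\<^sup>2" using t by (simp add: power2_eq_square)
      finally show ?thesis by simp
    qed
    ultimately show "\<exists>y. (?g has_real_derivative y) (at t) \<and> y \<le> 0" by blast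
  qed simp
  then show ?thesis unfolding lin_def by simp
qed

end

section \<open>The AIPP.S method\<close>

lemma first_hit_not_yet: "first_hit P k \<Longrightarrow> i < k \<Longrightarrow> not_yet P i"
  unfolding first_hit_def not_yet_def by auto

lemma first_hit_ex:
  assumes "\<exists>k. k \<ge> 1 \<and> P k"
  shows "\<exists>k. first_hit P k"
proof -
  let ?k = "LEAST k. k \<ge> 1 \<and> P k"
  have "?k \<ge> 1 \<and> P ?k" using assms by (rule LeastI_ex)
  moreover have "\<not> P j" if "1 \<le> j" "j < ?k" for j
    using not_less_Least[OF that(2)] that(1) by simp
  ultimately show ?thesis unfolding first_hit_def by blast
qed

lemma performs_oracle_calls_append:
  assumes "performs_oracle_calls k qs" "performs_oracle_calls k' qs'"
  shows "performs_oracle_calls (k + k') (qs @ qs')"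
proof -
  obtain cs cs' where "length cs = k" "concat cs = qs" "\<forall>c\<in>set cs. oracle_call c"
    "length cs' = k'" "concat cs' = qs'" "\<forall>c\<in>set cs'. oracle_call c"
    using assms unfolding performs_oracle_calls_def by blast
  then show ?thesis unfolding performs_oracle_calls_def by (intro exI[of _ "cs @ cs'"]) auto
qed

lemma performs_oracle_calls_single: "oracle_call c \<Longrightarrow> performs_oracle_calls 1 c"
  unfolding performs_oracle_calls_def by (intro exI[of _ "[c]"]) simp

locale aipp_run = saddle X D Y \<Omega> \<Phi> h m Lx Ly y0 \<xi> \<rho>
  for X D :: "'a::euclidean_space set" and Y :: "'b::euclidean_space set" and \<Omega> \<Phi> h m Lx Ly y0 \<xi> \<rho> +
  fixes x0 :: 'a
  assumes x0: "x0 \<in> X" and \<rho>: "\<rho> > 0" and points: "acg_points x0 \<subseteq> D"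
begin

section \<open>Parameters and the accelerated runs of the method\<close>

lemma lam_pos: "lam > 0" and lam_m: "lam * m = 1 / 2" and lam_inverse: "1 / lam = 2 * m"
  unfolding lam_def using parameters by auto

lemma mu_eq: "mu = 1 / 2"
  unfolding mu_def lam_m by simp

lemma L_bar_eq: "L_bar = M + 2 * m"
  unfolding L_bar_def lam_inverse using m_le_M by simp

lemma lam_L_bar: "lam * L_bar = L"
  unfolding L_bar_eq L_def distrib_left using lam_m by simp

lemma L_ge: "L \<ge> 3 / 2"
  using mult_left_mono[OF m_le_M, of lam] lam_pos lam_m unfolding L_def by simp

lemma L_pos: "L > 0"
  using L_ge by simp

lemma L_bar_pos: "L_bar > 0"
  unfolding L_bar_eq using M_pos parameters by simp

definition hr :: "'a \<Rightarrow> real" where "hr u = real_of_ereal (h u)"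
definition F :: "'a \<Rightarrow> real" where "F u = f u + hr u"

lemma h_eq: "u \<in> X \<Longrightarrow> h u = ereal (hr u)"
  unfolding hr_def by (rule closed_conv_ereal[OF h_conv])

lemma grad_psi_s:
  assumes "v \<in> \<Omega>"
  shows "grad (psi_s z) v = lam *\<^sub>R grad f v + (v - z)"
proof (rule grad_eqI)
  have f: "(f has_derivative (\<lambda>h. h \<bullet> grad f v)) (at v)"
    using Danskin_GDERIV_f[OF assms] grad_f[OF assms] unfolding gderiv_def by simp
  have "((\<lambda>u. lam * f u + (u - z) \<bullet> (u - z) / 2) has_derivative
      (\<lambda>h. lam * (h \<bullet> grad f v) + ((v - z) \<bullet> h + h \<bullet> (v - z)) / 2)) (at v)"
    by (rule derivative_eq_intros f refl | simp)+
  then show "GDERIV (psi_s z) v :> lam *\<^sub>R grad f v + (v - z)"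
    unfolding gderiv_def psi_s_def[abs_def] power2_norm_eq_inner
    by (simp add: inner_add_right inner_commute)
qed

lemma lin_psi_s:
  assumes "v \<in> \<Omega>"
  shows "lin (psi_s z) v u = lam * lin f v u + (norm (u - z))\<^sup>2 / 2 - (norm (u - v))\<^sup>2 / 2"
proof -
  have "(v - z) \<bullet> (u - v) = - ((z - v) \<bullet> (u - v))" by (simp add: inner_diff_left)
  then show ?thesis
    using norm_sq_three_points[of 1 u z v]
    unfolding lin_def grad_psi_s[OF assms] psi_s_def inner_add_left inner_scaleR_left distrib_left by linarith
qed

lemma acg_at:
  assumes "z \<in> X"
  shows "acg X D (psi_s z) psi_n z mu L"
proof
  show "closed_conv X psi_n"
    unfolding psi_n_def[abs_def] by (rule closed_conv_mult[OF h_conv lam_pos])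
  show "z \<in> X" by fact
  show "mu > 0" unfolding mu_eq by simp
  show "L > 0" by (rule L_pos)
next
  fix v u assume v: "v \<in> D" and u: "u \<in> X"
  then have v\<Omega>: "v \<in> \<Omega>" and uD: "u \<in> D" using D by auto
  have "lam * (lin f v u - m / 2 * (norm (u - v))\<^sup>2) \<le> lam * f u"
    using f_lower[OF uD v] lam_pos by (intro mult_left_mono) auto
  moreover have "lam * (m / 2 * (norm (u - v))\<^sup>2) = (lam * m) * ((norm (u - v))\<^sup>2 / 2)" by simp
  ultimately show "lin (psi_s z) v u + mu / 2 * (norm (u - v))\<^sup>2 \<le> psi_s z u"
    unfolding lin_psi_s[OF v\<Omega>] psi_s_def mu_eq lam_m right_diff_distrib by linarith
  have "lam * f u \<le> lam * (lin f v u + M / 2 * (norm (u - v))\<^sup>2)"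
    using f_upper[OF uD v] lam_pos by (intro mult_left_mono) auto
  then show "psi_s z u \<le> lin (psi_s z) v u + L / 2 * (norm (u - v))\<^sup>2"
    unfolding lin_psi_s[OF v\<Omega>] psi_s_def L_def distrib_left distrib_right add_divide_distrib by simp
qed

lemma acg_\<psi>:
  assumes "z \<in> X"
  shows "acg.\<psi> (psi_s z) psi_n u = lam * F u + (norm (u - z))\<^sup>2 / 2"
  unfolding acg.\<psi>_def[OF acg_at[OF assms]] acg.H_def[OF acg_at[OF assms]] psi_s_def psi_n_def F_def hr_def
  by (simp add: distrib_left)

abbreviation "yk z k \<equiv> acgy (state z k)"
abbreviation "Ak z k \<equiv> acgA (state z k)"
abbreviation "rk z k \<equiv> acg_r z (state z k)"
abbreviation "etak z k \<equiv> acg_eta (psi_s z) psi_n z (state z k)"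
abbreviation "wk z k \<equiv> z - yk z k + rk z k"
abbreviation "val z k \<equiv> acg.valid D (psi_s z) psi_n z mu L k"
abbreviation "err z k \<equiv> acg_rel_err (psi_s z) psi_n z (1/2) (state z k)"

lemma val_iff: "z \<in> X \<Longrightarrow> val z k \<longleftrightarrow> (\<forall>i<k. acg_extrap mu L (state z i) \<in> D)"
  unfolding state_def by (rule acg.valid_def[OF acg_at])

lemma center_in: "center x0 z \<Longrightarrow> z \<in> X"
proof (induction rule: center.induct)
  case (step z k)
  then show ?case using acg.y_in[OF acg_at] unfolding state_def by blast
qed (rule x0)

lemma stop1_iff: "stop1 z k \<longleftrightarrow> err z k \<and> Ak z k \<ge> 18"
  unfolding stop1_def acg1_stop_def Let_def sigma_def mu_eq state_def by simp

lemma stop2_iff: "stop2 z k \<longleftrightarrow> err z k \<and> etak z k \<le> lam * eps_bar"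
  unfolding stop2_def acg2_stop_def Let_def sigma_def state_def by simp

text \<open>\<open>acg_points\<close> contains the extrapolated point of state \<open>i\<close> if
  the test has failed at iterations \<open>1\<close> to \<open>i\<close>. The first \<open>k\<close>
  iterations start from the states \<open>i < k\<close>.\<close>

lemma val_stop1:
  assumes "center x0 z" "\<And>i. i < k \<Longrightarrow> not_yet (stop1 z) i"
  shows "val z k"
  using val_iff[OF center_in[OF assms(1)]] acg_points.acg1[OF assms(1)] assms(2) points by blast

lemma val_stop2:
  assumes "center x0 z" "first_hit (stop1 z) k" "small_res z k" "\<And>i. i < n \<Longrightarrow> not_yet (stop2 z) i"
  shows "val z n"
  using val_iff[OF center_in[OF assms(1)]] acg_points.acg2[OF assms(1-3)] assms(4) points by blast

lemma stop1_of_A: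
  assumes "center x0 z" "val z k" "k \<ge> 1" "Ak z k \<ge> 18"
  shows "stop1 z k"
  unfolding stop1_iff
  using acg.rel_err[OF acg_at[OF center_in[OF assms(1)]] assms(2,3)] assms(4) unfolding state_def by simp

lemma Ak_ge_square: "z \<in> X \<Longrightarrow> Ak z k \<ge> (real k)\<^sup>2 / (4 * L)"
  unfolding state_def by (rule acg.A_ge_square[OF acg_at])

lemma Ak_unbounded:
  assumes "z \<in> X"
  shows "\<exists>k\<ge>1. Ak z k \<ge> B"
proof -
  define k where "k = nat \<lceil>max 1 (4 * L * B)\<rceil>"
  have k: "real k \<ge> 1" "real k \<ge> 4 * L * B"
    unfolding k_def by linarith+
  have "real k * 1 \<le> real k * real k" using k(1) by (intro mult_left_mono) auto
  then have "4 * L * B \<le> (real k)\<^sup>2" using k(2) unfolding power2_eq_square by linarith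
  then have "B \<le> (real k)\<^sup>2 / (4 * L)" using L_pos by (simp add: field_simps)
  then show ?thesis using Ak_ge_square[OF assms, of k] k(1) by (intro exI[of _ k]) auto
qed

section \<open>Length and effect of an ACG1 run\<close>

lemma ACG1_terminates:
  assumes z: "center x0 z"
  shows "\<exists>k. first_hit (stop1 z) k"
proof (rule first_hit_ex, rule ccontr)
  assume no: "\<nexists>k. 1 \<le> k \<and> stop1 z k"
  obtain k where k: "k \<ge> 1" "Ak z k \<ge> 18" using Ak_unbounded[OF center_in[OF z]] by blast
  have "val z k" by (rule val_stop1[OF z]) (use no in \<open>auto simp: not_yet_def\<close>)
  then show False using stop1_of_A[OF z _ k] no k(1) by blast
qed

lemma ACG1_output:
  assumes z: "center x0 z" and k: "first_hit (stop1 z) k"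
  shows "val z k" "k \<ge> 1" "err z k" "Ak z k \<ge> 18"
  using val_stop1[OF z first_hit_not_yet[OF k]] k unfolding first_hit_def stop1_iff by auto

lemma ACG1_iterations:
  assumes z: "center x0 z" and k: "first_hit (stop1 z) k"
  shows "real k \<le> 1 + 9 * sqrt L"
proof (cases "k = 1")
  case False
  then have k1: "k - 1 \<ge> 1" "k - 1 < k" using ACG1_output(2)[OF z k] by auto
  have "val z (k - 1)"
    by (rule val_stop1[OF z]) (use first_hit_not_yet[OF k] in auto)
  moreover have "\<not> stop1 z (k - 1)" using k k1 unfolding first_hit_def by auto
  ultimately have "Ak z (k - 1) < 18" using stop1_of_A[OF z _ k1(1)] by force
  then have "(real (k - 1))\<^sup>2 / (4 * L) < 18"
    using Ak_ge_square[OF center_in[OF z], of "k - 1"] by linarith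
  \<comment> \<open>The last iteration but one fails the test, hence its coefficient is below 18;
    \<open>72 * L\<close> is rounded up to \<open>(9 * sqrt L)^2\<close>.\<close>
  then have "(real (k - 1))\<^sup>2 < 18 * (4 * L)"
    using L_pos by (subst (asm) pos_divide_less_eq) auto
  moreover have "(9 * sqrt L)\<^sup>2 = 81 * L" using L_pos by (simp add: power_mult_distrib)
  ultimately have "(real (k - 1))\<^sup>2 \<le> (9 * sqrt L)\<^sup>2" using L_pos by linarith
  then have "real (k - 1) \<le> 9 * sqrt L"
    by (rule power2_le_imp_le) (use L_pos in simp)
  then show ?thesis using k1 by (simp add: of_nat_diff)
qed (use L_pos in simp)

text \<open>The subgradient inequality is taken at the centre \<open>z\<close>. Completing the
  square to \<open>wk z k\<close> costs \<open>(|r|^2 + 2 \<eta>) / 2\<close>, at most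
  \<open>|w|^2 / 4\<close> by the relative error test, out of the available
  \<open>|w|^2 / 2\<close>.\<close>

lemma ACG1_descent:
  assumes z: "center x0 z" and k: "first_hit (stop1 z) k"
  shows "lam * F (yk z k) + (norm (wk z k))\<^sup>2 / 4 \<le> lam * F z"
proof -
  note zX = center_in[OF z]
  interpret A: acg X D "psi_s z" psi_n z mu L by (rule acg_at[OF zX])
  note o = ACG1_output[OF z k]
  have "A.\<psi> (yk z k) + rk z k \<bullet> (z - yk z k) - etak z k \<le> A.\<psi> z"
    using A.subgradient[OF o(1,2) zX] A.\<mu> unfolding state_def
    by (smt (verit) divide_nonneg_pos mult_nonneg_nonneg zero_le_power2)
  moreover have "(norm (wk z k))\<^sup>2 = (norm (yk z k - z))\<^sup>2 + 2 * (rk z k \<bullet> (z - yk z k)) + (norm (rk z k))\<^sup>2"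
    unfolding power2_norm_eq_inner by (simp add: algebra_simps inner_commute)
  moreover have "(norm (rk z k))\<^sup>2 + 2 * etak z k \<le> (norm (wk z k))\<^sup>2 / 2"
    using o(3) unfolding acg_rel_err_def by simp
  moreover have "A.\<psi> z = lam * F z" unfolding acg_\<psi>[OF zX] by simp
  ultimately show ?thesis using acg_\<psi>[OF zX, of "yk z k"] by linarith
qed

text \<open>The comparison point is arbitrary, which later allows taking the infimum in the Moreau
  gap. Only \<open>Ak z k \<ge> 1\<close> is needed.\<close>

lemma ACG1_first_step:
  assumes z: "center x0 z" and k: "first_hit (stop1 z) k" and u: "u \<in> X"
  shows "lam * F (yk z k) \<le> lam * F u + (norm (z - u))\<^sup>2"
proof -
  note zX = center_in[OF z]
  interpret A: acg X D "psi_s z" psi_n z mu L by (rule acg_at[OF zX])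
  note o = ACG1_output[OF z k]
  let ?t = "(norm (u - z))\<^sup>2"
  have "Ak z k * A.\<psi> (yk z k) \<le> Ak z k * A.\<psi> u + ?t / 2"
  proof -
    have "(1 + mu * Ak z k) / 2 * (norm (u - acgx (state z k)))\<^sup>2 \<ge> 0"
      using A.\<mu> A.A_nonneg[of k] unfolding state_def by (simp add: add_nonneg_nonneg)
    then show ?thesis using A.\<psi>_y_gap[OF o(1) u] unfolding state_def by linarith
  qed
  also have "\<dots> \<le> Ak z k * A.\<psi> u + Ak z k * (?t / 2)"
    using o(4) mult_right_mono[of 1 "Ak z k" "?t / 2"] by simp
  finally have "Ak z k * A.\<psi> (yk z k) \<le> Ak z k * (A.\<psi> u + ?t / 2)" by (simp add: distrib_left)
  then have "A.\<psi> (yk z k) \<le> A.\<psi> u + ?t / 2" using o(4) by simp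
  then have "lam * F (yk z k) + (norm (yk z k - z))\<^sup>2 / 2 \<le> lam * F u + ?t"
    unfolding acg_\<psi>[OF zX] by simp
  then show ?thesis using zero_le_power2[of "norm (yk z k - z)"] unfolding norm_minus_commute[of z] by linarith
qed

section \<open>The ACG2 run after a small residual\<close>

context
  fixes z k
  assumes z: "center x0 z" and k: "first_hit (stop1 z) k" and small: "small_res z k"
begin

lemma acg_half_at: "acg_half X D (psi_s z) psi_n z mu L k"
proof -
  interpret A: acg X D "psi_s z" psi_n z mu L by (rule acg_at[OF center_in[OF z]])
  note o = ACG1_output[OF z k]
  show ?thesis
  proof
    show "mu = 1 / 2" by (rule mu_eq)
    show "A.valid k" "1 \<le> k" by (rule o)+
    show "18 \<le> A.A k" using o(4) unfolding state_def .
  qed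
qed

lemma small_residual: "norm (wk z k) \<le> lam * \<rho> / 20"
  using small unfolding small_res_def rho_bar_def by simp

lemma stop2_of_A:
  assumes n: "val z n" "n \<ge> 1" "Ak z n \<ge> 8 * L"
  shows "stop2 z n"
  unfolding stop2_iff
proof
  interpret A: acg_half X D "psi_s z" psi_n z mu L k by (rule acg_half_at)
  have A8: "Ak z n \<ge> 8" using n(3) L_ge by simp
  then show "err z n" using A.rel_err[OF n(1,2)] unfolding state_def by simp
  have "etak z n \<le> 81 / 32 * (norm (wk z k))\<^sup>2 / Ak z n"
    using A.\<eta>_le_residual[OF n(1,2)] unfolding state_def .
  also have "\<dots> \<le> 81 / 32 * (lam * \<rho> / 20)\<^sup>2 / (8 * L)"
    using small_residual n(3) L_pos A8 by (intro frac_le mult_left_mono power_mono) auto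
  also have "\<dots> \<le> (lam * \<rho>)\<^sup>2 / (32 * L)"
    using L_pos by (simp add: power_divide field_simps)
  also have "\<dots> = lam * (\<rho>\<^sup>2 / (32 * L_bar))"
    unfolding lam_L_bar[symmetric] using lam_pos by (simp add: power2_eq_square)
  also have "\<dots> = lam * eps_bar" unfolding eps_bar_def L_bar_def ..
  finally show "etak z n \<le> lam * eps_bar" .
qed

lemma ACG2_terminates: "\<exists>n. first_hit (stop2 z) n"
proof (rule first_hit_ex, rule ccontr)
  assume no: "\<nexists>n. 1 \<le> n \<and> stop2 z n"
  obtain n where n: "n \<ge> 1" "Ak z n \<ge> 8 * L" using Ak_unbounded[OF center_in[OF z]] by blast
  have "val z n" by (rule val_stop2[OF z k small]) (use no in \<open>auto simp: not_yet_def\<close>)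
  then show False using stop2_of_A[OF _ n] no n(1) by blast
qed

context
  fixes n
  assumes n: "first_hit (stop2 z) n"
begin

lemma ACG2_output: "val z n" "n \<ge> 1" "err z n" "etak z n \<le> lam * eps_bar"
  using val_stop2[OF z k small first_hit_not_yet[OF n]] n unfolding first_hit_def stop2_iff by auto

lemma ACG2_iterations: "real n \<le> 2 + 2 * sqrt (2 * L) * ln (8 * L\<^sup>2)"
proof (cases "n = 1")
  case True
  have "1 \<le> L\<^sup>2" using L_ge by (simp add: one_le_power)
  then have "ln (8 * L\<^sup>2) \<ge> 0" by simp
  then show ?thesis using True L_pos by simp
next
  case False
  \<comment> \<open>One unit is lost because iteration \<open>n - 1\<close> is the last that fails
    the test, another because the geometric growth starts at \<open>A 1\<close>.\<close>
  define j where "j = n - 2"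
  have j: "n = Suc (Suc j)" using False ACG2_output(2) unfolding j_def by simp
  interpret A: acg X D "psi_s z" psi_n z mu L by (rule acg_at[OF center_in[OF z]])
  define s where "s = sqrt (mu / L) / 2"
  have sL: "s * (2 * sqrt (2 * L)) = 1"
    unfolding s_def mu_eq using L_pos by (simp add: real_sqrt_divide real_sqrt_mult)
  have s0: "s > 0" unfolding s_def mu_eq using L_pos by simp
  have "mu / L \<le> 1" using L_ge unfolding mu_eq by (simp add: field_simps)
  then have s1: "s \<le> 1 / 2" unfolding s_def by simp
  have "val z (Suc j)"
    by (rule val_stop2[OF z k small]) (use first_hit_not_yet[OF n] j in auto)
  moreover have "\<not> stop2 z (Suc j)" using n j unfolding first_hit_def by auto
  ultimately have "Ak z (Suc j) < 8 * L" using stop2_of_A[of "Suc j"] by force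
  then have "(1 + s) ^ (2 * j) / L < 8 * L"
    using A.A_ge_geometric[of j] unfolding s_def state_def by linarith
  then have "(1 + s) ^ (2 * j) < 8 * L\<^sup>2"
    using L_pos by (simp add: field_simps power2_eq_square)
  then have "ln ((1 + s) ^ (2 * j)) < ln (8 * L\<^sup>2)" using s0 L_pos by simp
  then have "real (2 * j) * ln (1 + s) < ln (8 * L\<^sup>2)" using s0 by (simp add: ln_realpow)
  moreover have "s / 2 \<le> ln (1 + s)"
  proof -
    have "s * s \<le> s * (1 / 2)" using s0 s1 by (intro mult_left_mono) auto
    then show ?thesis
      using ln_one_plus_pos_lower_bound[of s] s0 s1 unfolding power2_eq_square by linarith
  qed
  then have "real (2 * j) * (s / 2) \<le> real (2 * j) * ln (1 + s)" by (intro mult_left_mono) auto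
  ultimately have "real j * s < ln (8 * L\<^sup>2)" by simp
  then have "(2 * sqrt (2 * L)) * (real j * s) \<le> 2 * sqrt (2 * L) * ln (8 * L\<^sup>2)"
    using L_pos by (intro mult_left_mono) auto
  moreover have "(2 * sqrt (2 * L)) * (real j * s) = real j * (s * (2 * sqrt (2 * L)))"
    by (simp only: mult_ac)
  ultimately have "real j \<le> 2 * sqrt (2 * L) * ln (8 * L\<^sup>2)" unfolding sL by simp
  then show ?thesis unfolding j by simp
qed

lemma ACG2_residual: "norm (wk z n) \<le> lam * (\<rho> / 4)"
proof -
  interpret A: acg_half X D "psi_s z" psi_n z mu L k by (rule acg_half_at)
  have "norm (wk z n) \<le> 5 * norm (wk z k)"
    using A.residual_le[OF ACG2_output(1,2)] ACG2_output(3) unfolding state_def by simp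
  then show ?thesis using small_residual by simp
qed

text \<open>The proximal term centred at \<open>z\<close> is expanded around the output; its linear
  part joins \<open>rk z n\<close> and forms the residual.\<close>

lemma ACG2_subgradient:
  assumes u: "u \<in> X"
  shows "lam * F (yk z n) - etak z n
    \<le> lam * F u + (norm (u - yk z n))\<^sup>2 / 2 - wk z n \<bullet> (u - yk z n)"
proof -
  note zX = center_in[OF z]
  interpret A: acg X D "psi_s z" psi_n z mu L by (rule acg_at[OF zX])
  have "A.\<psi> (yk z n) + rk z n \<bullet> (u - yk z n) - etak z n \<le> A.\<psi> u"
    using A.subgradient[OF ACG2_output(1,2) u] A.\<mu> unfolding state_def
    by (smt (verit) divide_nonneg_pos mult_nonneg_nonneg zero_le_power2)
  moreover have "wk z n \<bullet> (u - yk z n) = (z - yk z n) \<bullet> (u - yk z n) + rk z n \<bullet> (u - yk z n)"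
    by (rule inner_add_left)
  ultimately show ?thesis
    using norm_sq_three_points[of 1 u z "yk z n"] unfolding acg_\<psi>[OF zX] by linarith
qed

end
end

section \<open>The refinement step and the solution conditions\<close>

lemma refine_x_min:
  assumes z: "z \<in> X"
  defines "x \<equiv> refine_x z"
  shows "x \<in> X"
    and "u \<in> X \<Longrightarrow> hr x + grad f z \<bullet> (x - z) + L_bar / 2 * (norm (x - z))\<^sup>2 + L_bar / 2 * (norm (u - x))\<^sup>2
      \<le> hr u + grad f z \<bullet> (u - z) + L_bar / 2 * (norm (u - z))\<^sup>2"
proof -
  let ?Q = "\<lambda>u. ereal (lin f z u) + h u + ereal (L_bar / 2 * (norm (u - z))\<^sup>2)"
  have Q: "?Q u = ereal (1 * (real_of_ereal (h u) + grad f z \<bullet> (u - z) + L_bar / 2 * (norm (u - z))\<^sup>2) + f z)"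
    if "u \<in> X" for u
    unfolding h_eq[OF that] lin_def by simp
  have Qout: "?Q u = \<infinity>" if "u \<notin> X" for u
    using closed_conv_outside[OF h_conv that] by simp
  note min = closed_conv_prox_arg_min[where Q = "?Q" and g = "grad f z" and z = z and d = "f z",
      OF h_conv L_bar_pos zero_less_one Q Qout refine_x_def]
  show "x \<in> X" unfolding x_def by (rule min(1))
  assume "u \<in> X"
  then show "hr x + grad f z \<bullet> (x - z) + L_bar / 2 * (norm (x - z))\<^sup>2 + L_bar / 2 * (norm (u - x))\<^sup>2
      \<le> hr u + grad f z \<bullet> (u - z) + L_bar / 2 * (norm (u - z))\<^sup>2"
    unfolding x_def hr_def using min(2) by blast
qed

lemma refine_subgradient:
  assumes z: "z \<in> X"
  defines "x \<equiv> refine_x z"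
  shows "L_bar *\<^sub>R (z - x) - grad f z \<in> subdiff h x"
  unfolding subdiff_def
proof (intro CollectI allI)
  fix u
  note x = refine_x_min[OF z, folded x_def]
  show "h x + ereal ((L_bar *\<^sub>R (z - x) - grad f z) \<bullet> (u - x)) \<le> h u"
  proof (cases "u \<in> X")
    case True
    have "grad f z \<bullet> (u - z) = grad f z \<bullet> (u - x) + grad f z \<bullet> (x - z)" by (simp add: inner_diff_right)
    then have "hr x + (L_bar * ((z - x) \<bullet> (u - x)) - grad f z \<bullet> (u - x)) \<le> hr u"
      using x(2)[OF True] norm_sq_three_points[of L_bar u z x] by linarith
    then show ?thesis
      unfolding h_eq[OF True] h_eq[OF x(1)] by (simp add: inner_diff_left)
  next
    case False
    then show ?thesis using closed_conv_outside[OF h_conv] by simp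
  qed
qed

text \<open>Tilting the composite step by \<open>w / \<lambda>\<close> gives a step whose length is controlled by \<open>\<epsilon>\<close>
  alone; the two steps differ by at most \<open>|w| / (\<lambda> L_bar)\<close>, since proximal maps are nonexpansive.\<close>

lemma refine_step_le:
  assumes z: "z \<in> X"
    and sub: "\<And>u. u \<in> X \<Longrightarrow> lam * F z - \<epsilon> \<le> lam * F u + (norm (u - z))\<^sup>2 / 2 - w \<bullet> (u - z)"
    and \<epsilon>: "\<epsilon> \<le> lam * eps_bar" and w: "norm w \<le> lam * (\<rho> / 4)"
  shows "L_bar * norm (refine_x z - z) \<le> \<rho> / 2"
proof -
  define x where "x = refine_x z"
  note x = refine_x_min[OF z, folded x_def]
  let ?g = "grad f z - (1 / lam) *\<^sub>R w"
  obtain v where v: "v \<in> X" "\<And>u. u \<in> X \<Longrightarrow>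
     hr v + ?g \<bullet> (v - z) + L_bar / 2 * (norm (v - z))\<^sup>2 \<le> hr u + ?g \<bullet> (u - z) + L_bar / 2 * (norm (u - z))\<^sup>2"
    unfolding hr_def using closed_conv_prox_exists[OF h_conv L_bar_pos, of ?g z] by blast
  have hr_convex: "convex_on X hr"
    unfolding hr_def by (rule closed_conv_convex_on[OF h_conv])
  have v_min: "hr v + ?g \<bullet> (v - z) + L_bar / 2 * (norm (v - z))\<^sup>2 + L_bar / 2 * (norm (u - v))\<^sup>2
      \<le> hr u + ?g \<bullet> (u - z) + L_bar / 2 * (norm (u - z))\<^sup>2" if "u \<in> X" for u
    by (rule strongly_convex_min[OF hr_convex v(1) that v(2)])
  have g: "?g \<bullet> t = grad f z \<bullet> t - (w \<bullet> t) / lam" for t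
    by (simp add: inner_diff_left)
  let ?s = "norm (v - z)"
  have "L_bar * ?s \<le> \<rho> / 4"
  proof -
    have zv: "norm (z - v) = ?s" by (rule norm_minus_commute)
    \<comment> \<open>Minimality of \<open>v\<close> tested at \<open>z\<close> and near-minimality
      of \<open>z\<close> tested at \<open>v\<close> combine to
      \<open>L / 2 * ?s^2 \<le> \<epsilon>\<close>, as
      \<open>lam * L_bar - lam * M / 2 - 1 / 2 = L / 2\<close>. The value of \<open>eps_bar\<close>
      makes \<open>2 * L_bar * eps_bar\<close> equal to \<open>(\<rho> / 4)^2\<close>.\<close>
    have "hr v + (grad f z \<bullet> (v - z) - (w \<bullet> (v - z)) / lam) + L_bar * ?s\<^sup>2 \<le> hr z"
      using v_min[OF z] unfolding g zv by simp
    moreover have "f v \<le> f z + grad f z \<bullet> (v - z) + M / 2 * ?s\<^sup>2"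
      using f_upper[of v z] D v(1) z unfolding lin_def by auto
    ultimately have "F v - (w \<bullet> (v - z)) / lam \<le> F z - (L_bar - M / 2) * ?s\<^sup>2"
      unfolding F_def left_diff_distrib by linarith
    then have "lam * (F v - (w \<bullet> (v - z)) / lam) \<le> lam * (F z - (L_bar - M / 2) * ?s\<^sup>2)"
      using lam_pos by (intro mult_left_mono) auto
    moreover have "lam * ((w \<bullet> (v - z)) / lam) = w \<bullet> (v - z)" using lam_pos by simp
    moreover have "lam * ((L_bar - M / 2) * ?s\<^sup>2) = (lam * L_bar - lam * M / 2) * ?s\<^sup>2"
      by (simp add: algebra_simps)
    ultimately have "lam * F v - w \<bullet> (v - z) \<le> lam * F z - (lam * L_bar - lam * M / 2) * ?s\<^sup>2"
      unfolding right_diff_distrib by linarith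
    also have "lam * L_bar - lam * M / 2 = L / 2 + 1 / 2"
      unfolding lam_L_bar L_def by (simp add: add_divide_distrib)
    finally have "L / 2 * ?s\<^sup>2 \<le> \<epsilon>"
      using sub[OF v(1)] unfolding distrib_right by linarith
    then have "lam * (L_bar / 2 * ?s\<^sup>2) \<le> lam * eps_bar"
      unfolding lam_L_bar[symmetric] using \<epsilon> by (simp add: mult.assoc)
    then have "L_bar / 2 * ?s\<^sup>2 \<le> eps_bar" using lam_pos by simp
    then have "2 * L_bar * (L_bar / 2 * ?s\<^sup>2) \<le> 2 * L_bar * eps_bar"
      using L_bar_pos by (intro mult_left_mono) auto
    then have "(L_bar * ?s)\<^sup>2 \<le> 2 * L_bar * eps_bar" by (simp add: power2_eq_square mult_ac)
    also have "\<dots> = (\<rho> / 4)\<^sup>2"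
      unfolding eps_bar_def L_bar_def[symmetric] using L_bar_pos by (simp add: power_divide)
    finally show ?thesis by (rule power2_le_imp_le) (use \<rho> in simp)
  qed
  moreover have "L_bar * norm (x - v) \<le> \<rho> / 4"
  proof -
    let ?t = "norm (x - v)"
    have vx: "norm (v - x) = ?t" by (rule norm_minus_commute)
    have "L_bar * ?t\<^sup>2 \<le> - ((w \<bullet> (x - v)) / lam)"
    proof -
      have "(w \<bullet> (x - z)) / lam = (w \<bullet> (x - v)) / lam + (w \<bullet> (v - z)) / lam"
        unfolding add_divide_distrib[symmetric] inner_add_right[symmetric] by simp
      then show ?thesis
        using x(2)[OF v(1)] v_min[OF x(1)] unfolding g vx by linarith
    qed
    also have "\<dots> \<le> norm w / lam * ?t"
      using Cauchy_Schwarz_ineq2[of w "x - v"] lam_pos by (simp add: field_simps)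
    also have "\<dots> \<le> \<rho> / 4 * ?t"
      using w lam_pos by (intro mult_right_mono) (auto simp: field_simps)
    finally have "(L_bar * ?t) * ?t \<le> \<rho> / 4 * ?t" by (simp add: power2_eq_square)
    then show ?thesis using \<rho> by (cases "?t = 0") (auto simp: mult_le_cancel_right)
  qed
  moreover have "norm (x - z) \<le> norm (x - v) + ?s"
    using norm_triangle_ineq[of "x - v" "v - z"] by simp
  then have "L_bar * norm (x - z) \<le> L_bar * (norm (x - v) + ?s)"
    using L_bar_pos by (intro mult_left_mono) auto
  ultimately show ?thesis unfolding x_def distrib_left by linarith
qed

lemma norm_refine_u:
  assumes z: "z \<in> X" and step: "L_bar * norm (refine_x z - z) \<le> \<rho> / 2"
  shows "norm (refine_u z) \<le> \<rho>"
proof -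
  let ?x = "refine_x z"
  have xX: "?x \<in> X" by (rule refine_x_min(1)[OF z])
  have "refine_u z = L_bar *\<^sub>R (z - ?x) + (grad f ?x - grad f z)" unfolding refine_u_def by simp
  then have "norm (refine_u z) \<le> norm (L_bar *\<^sub>R (z - ?x)) + norm (grad f ?x - grad f z)"
    using norm_triangle_ineq by metis
  also have "norm (L_bar *\<^sub>R (z - ?x)) = L_bar * norm (?x - z)"
    using L_bar_pos by (simp add: norm_minus_commute)
  also have "norm (grad f ?x - grad f z) \<le> M * norm (?x - z)"
    using D xX z by (intro grad_f_Lipschitz) auto
  also have "M * norm (?x - z) \<le> L_bar * norm (?x - z)"
    unfolding L_bar_eq using parameters by (intro mult_right_mono) auto
  finally show ?thesis using step by simp
qed

lemma outputs_solution:
  assumes "outputs z x u qs" "center x0 z"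
  shows "x \<in> X \<and> norm u \<le> \<rho> \<and> u \<in> (\<lambda>g. grad_x \<Phi> x (y_xi x) + g) ` subdiff h x"
  using assms
proof (induction rule: outputs.induct)
  case (stop z k k' z')
  have z': "z' \<in> X"
    using acg.y_in[OF acg_at[OF center_in[OF stop.prems]]] stop.hyps unfolding state_def by simp
  have xX: "refine_x z' \<in> X" by (rule refine_x_min(1)[OF z'])
  note hyps = stop.prems stop.hyps(1,2,3)
  have "L_bar * norm (refine_x z' - z') \<le> \<rho> / 2"
    by (rule refine_step_le[OF z' ACG2_subgradient[OF hyps, folded stop.hyps(4)]
          ACG2_output(4)[OF hyps] ACG2_residual[OF hyps, folded stop.hyps(4)]])
  then have "norm (refine_u z') \<le> \<rho>" by (rule norm_refine_u[OF z'])
  moreover have "refine_u z' = grad_x \<Phi> (refine_x z') (y_xi (refine_x z'))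
      + (L_bar *\<^sub>R (z' - refine_x z') - grad f z')"
    using grad_f[of "refine_x z'"] xX Omega(2) unfolding refine_u_def by auto
  ultimately show ?case using refine_subgradient[OF z'] xX by blast
next
  case (continue z k x u qs)
  then show ?case using center.step by blast
qed

section \<open>Grouping of queries and number of runs\<close>

lemma oracle_call_acg_queries: "oracle_call (acg_queries z k)"
  unfolding oracle_call_def acg_queries_def Let_def value_queries_def grad_queries_def oracle_call_size_def
  by simp

text \<open>The refinement evaluates neither \<open>\<Phi>\<close> nor \<open>h\<close>, so its
  queries alone are no oracle call. They are attached to the last ACG2 iteration; together these are
  13 queries.\<close>

lemma oracle_call_acg_refine_queries: "oracle_call (acg_queries z k @ refine_queries z')"
  unfolding oracle_call_def acg_queries_def refine_queries_def Let_def value_queries_def grad_queries_def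
    oracle_call_size_def
  by simp

lemma acg_run_queries_Suc: "acg_run_queries z (Suc k) = acg_run_queries z k @ acg_queries z (Suc k)"
  unfolding acg_run_queries_def by simp

lemma performs_acg_run_queries: "performs_oracle_calls k (acg_run_queries z k)"
proof (induction k)
  case 0
  show ?case unfolding performs_oracle_calls_def acg_run_queries_def by simp
next
  case (Suc k)
  then show ?case
    using performs_oracle_calls_append[OF Suc performs_oracle_calls_single[OF oracle_call_acg_queries]]
    unfolding acg_run_queries_Suc by simp
qed

lemma performs_acg_refine_queries:
  assumes "k \<ge> 1"
  shows "performs_oracle_calls k (acg_run_queries z k @ refine_queries z')"
proof -
  obtain j where j: "k = Suc j" using assms by (cases k) auto
  have "performs_oracle_calls (j + 1) (acg_run_queries z j @ (acg_queries z k @ refine_queries z'))"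
    by (rule performs_oracle_calls_append[OF performs_acg_run_queries
          performs_oracle_calls_single[OF oracle_call_acg_refine_queries]])
  then show ?thesis unfolding j acg_run_queries_Suc by simp
qed

text \<open>The guaranteed decrease of \<open>F\<close> in a run with large residual:
  \<open>(lam * \<rho> / 20)^2 / 4\<close>, divided by \<open>lam\<close>.\<close>

definition \<delta> :: real where "\<delta> = lam * \<rho>\<^sup>2 / 1600"
definition K1 :: real where "K1 = 1 + 9 * sqrt L"
definition K2 :: real where "K2 = 2 + 2 * sqrt (2 * L) * ln (8 * L\<^sup>2)"

lemma \<delta>_pos: "\<delta> > 0"
  unfolding \<delta>_def using lam_pos \<rho> by simp

lemma K1_pos: "K1 > 0"
  unfolding K1_def using L_pos by (simp add: add_pos_nonneg)

lemma F_drop: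
  assumes z: "center x0 z" "first_hit (stop1 z) k" "\<not> small_res z k"
  shows "F (yk z k) + \<delta> \<le> F z"
proof -
  have "lam * \<rho> / 20 \<le> norm (wk z k)"
    using z(3) unfolding small_res_def rho_bar_def by simp
  then have "(lam * \<rho> / 20)\<^sup>2 \<le> (norm (wk z k))\<^sup>2" using lam_pos \<rho> by (intro power_mono) auto
  moreover have "(lam * \<rho> / 20)\<^sup>2 = 4 * (lam * \<delta>)" unfolding \<delta>_def by (simp add: power2_eq_square)
  ultimately have "lam * (F (yk z k) + \<delta>) \<le> lam * F z"
    using ACG1_descent[OF z(1,2)] unfolding distrib_left by linarith
  then show ?thesis using lam_pos by simp
qed

text \<open>\<open>outputs\<close> records finished runs only. Every continuation lowers
  \<open>F\<close> by \<open>\<delta>\<close>, so induction on the number of decreases that still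
  fit above the lower bound yields a finished run.\<close>

lemma outputs_exist:
  assumes lb: "\<And>u. u \<in> X \<Longrightarrow> Fl \<le> F u" and z: "center x0 z"
  shows "\<exists>x u qs. outputs z x u qs"
proof -
  have "\<exists>x u qs. outputs z x u qs" if "center x0 z" "F z - Fl < real n * \<delta>" for n z
    using that
  proof (induction n arbitrary: z)
    case 0
    then show ?case using lb[OF center_in] by force
  next
    case (Suc n)
    obtain k where k: "first_hit (stop1 z) k" using ACG1_terminates[OF Suc.prems(1)] by blast
    show ?case
    proof (cases "small_res z k")
      case True
      obtain k' where "first_hit (stop2 z) k'" using ACG2_terminates[OF Suc.prems(1) k True] by blast
      then show ?thesis using outputs.stop[OF k True] by blast
    next
      case False
      have "F (yk z k) - Fl < real n * \<delta>"
        using F_drop[OF Suc.prems(1) k False] Suc.prems(2) by (simp add: algebra_simps)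
      then show ?thesis
        using Suc.IH[OF center.step[OF Suc.prems(1) k False]] outputs.continue[OF k False] by blast
    qed
  qed
  moreover obtain n :: nat where "(F z - Fl) / \<delta> < real n" using reals_Archimedean2 by blast
  then have "F z - Fl < real n * \<delta>" using \<delta>_pos by (simp add: field_simps)
  ultimately show ?thesis using z by blast
qed

text \<open>Amortized count: a continuation costs at most \<open>K1\<close> and lowers
  \<open>(F z - Fl) / \<delta>\<close> by at least 1.\<close>

lemma outputs_count:
  assumes lb: "\<And>u. u \<in> X \<Longrightarrow> Fl \<le> F u" and "outputs z x u qs" "center x0 z"
  shows "\<exists>N. performs_oracle_calls N qs \<and> real N \<le> K1 * ((F z - Fl) / \<delta> + 1) + K2"
  using assms(2,3)
proof (induction rule: outputs.induct)
  case (stop z k k' z')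
  note hyps = stop.prems stop.hyps(1,2,3)
  have "performs_oracle_calls (k + k') (acg_run_queries z k @ acg_run_queries z k' @ refine_queries z')"
    by (rule performs_oracle_calls_append[OF performs_acg_run_queries
          performs_acg_refine_queries[OF ACG2_output(2)[OF hyps]]])
  moreover have "real k \<le> K1" "real k' \<le> K2"
    unfolding K1_def K2_def
    using ACG1_iterations[OF stop.prems stop.hyps(1)] ACG2_iterations[OF hyps] by auto
  moreover have "K1 * ((F z - Fl) / \<delta>) \<ge> 0"
    using lb[OF center_in[OF stop.prems]] K1_pos \<delta>_pos by simp
  ultimately show ?case unfolding distrib_left by (intro exI[of _ "k + k'"]) auto
next
  case (continue z k x u qs)
  note hyps = continue.prems continue.hyps(1,2)
  obtain N where N: "performs_oracle_calls N qs" "real N \<le> K1 * ((F (yk z k) - Fl) / \<delta> + 1) + K2"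
    using continue.IH center.step[OF hyps] by blast
  have "(F (yk z k) - Fl) / \<delta> + 1 = (F (yk z k) + \<delta> - Fl) / \<delta>"
    using \<delta>_pos by (simp add: field_simps)
  also have "\<dots> \<le> (F z - Fl) / \<delta>"
    using F_drop[OF hyps] \<delta>_pos by (intro divide_right_mono) auto
  finally have "(F (yk z k) - Fl) / \<delta> + 1 \<le> (F z - Fl) / \<delta>" .
  then have "K1 * ((F (yk z k) - Fl) / \<delta> + 1) \<le> K1 * ((F z - Fl) / \<delta>)"
    using K1_pos by (intro mult_left_mono) auto
  moreover have "real k \<le> K1"
    unfolding K1_def by (rule ACG1_iterations[OF hyps(1,2)])
  ultimately have "real (k + N) \<le> K1 * ((F z - Fl) / \<delta> + 1) + K2"
    using N(2) unfolding distrib_left by simp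
  then show ?case using performs_oracle_calls_append[OF performs_acg_run_queries N(1)] by blast
qed

section \<open>Bounds in terms of \<open>Omega_xi\<close>\<close>

abbreviation "Om \<equiv> Omega_xi m Lx Ly \<xi>"

lemma Om_ge: "Om \<ge> 2"
proof -
  have "sqrt m \<le> sqrt Lx" using parameters by simp
  then have "sqrt m \<le> sqrt \<xi> * Ly + sqrt Lx"
    using parameters \<xi> by (intro add_increasing) auto
  then have "1 \<le> (sqrt \<xi> * Ly + sqrt Lx) / sqrt m"
    using parameters by (simp add: le_divide_eq)
  then show ?thesis unfolding Omega_xi_def by simp
qed

text \<open>By subadditivity of the square root \<open>M\<close> is at most the square of
  \<open>sqrt \<xi> * Ly + sqrt Lx + sqrt m\<close>, which is \<open>m * Om^2\<close>. Multiplying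
  by \<open>lam\<close> halves \<open>Om^2\<close>, and \<open>Om \<ge> 2\<close> absorbs the 1 in
  \<open>L\<close>.\<close>

lemma L_le: "L \<le> Om\<^sup>2"
proof -
  define a b c where "a = sqrt \<xi> * Ly" and "b = sqrt Lx" and "c = sqrt m"
  have pos: "a \<ge> 0" "b \<ge> 0" "c > 0" unfolding a_def b_def c_def using \<xi> parameters by auto
  have sq: "b\<^sup>2 = Lx" "c\<^sup>2 = m" "a\<^sup>2 = \<xi> * Ly\<^sup>2"
    unfolding a_def b_def c_def using \<xi> parameters by (auto simp: power_mult_distrib)
  have "sqrt (Lx + m) \<le> b + c"
    unfolding b_def c_def using parameters by (intro sqrt_add_le_add_sqrt) auto
  then have "a * sqrt (Lx + m) \<le> a * (b + c)" using pos by (intro mult_left_mono) auto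
  moreover have "M = a\<^sup>2 + a * sqrt (Lx + m) + b\<^sup>2"
    unfolding sq unfolding M_def a_def real_sqrt_mult[of \<xi>]
    by (simp add: algebra_simps power2_eq_square)
  ultimately have "M \<le> a\<^sup>2 + a * (b + c) + b\<^sup>2" by simp
  also have "\<dots> \<le> (a + b + c)\<^sup>2"
    using pos by (simp add: power2_eq_square algebra_simps add_increasing)
  also have "a + b + c = c * Om"
    unfolding Omega_xi_def a_def[symmetric] b_def[symmetric] c_def[symmetric] using pos by (simp add: field_simps)
  finally have "M \<le> m * Om\<^sup>2" unfolding power_mult_distrib sq .
  then have "lam * M \<le> lam * (m * Om\<^sup>2)" using lam_pos by (intro mult_left_mono) auto
  also have "\<dots> = Om\<^sup>2 / 2" unfolding mult.assoc[symmetric] lam_m by simp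
  finally have "L \<le> 1 + Om\<^sup>2 / 2" unfolding L_def by simp
  moreover have "2\<^sup>2 \<le> Om\<^sup>2" using Om_ge by (intro power_mono) auto
  ultimately show ?thesis by simp
qed

lemma sqrt_L_le: "sqrt L \<le> Om"
  using L_le Om_ge by (simp add: real_le_lsqrt)

lemma K1_le: "K1 \<le> 10 * Om"
  unfolding K1_def using sqrt_L_le Om_ge by simp

lemma K2_le: "K2 \<le> 34 * (Om * log1_plus Om)"
proof -
  let ?l = "log1_plus Om"
  have l: "?l \<ge> 1" "ln Om \<le> ?l" unfolding log1_plus_def by auto
  have "sqrt 2 \<le> 3 / 2" by (rule real_le_lsqrt) (auto simp: power2_eq_square)
  then have "sqrt 2 * sqrt L \<le> 3 / 2 * Om" using sqrt_L_le L_pos by (intro mult_mono) auto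
  then have 1: "2 * sqrt (2 * L) \<le> 3 * Om" unfolding real_sqrt_mult by simp
  have "ln L \<le> ln (Om\<^sup>2)" using L_le L_pos Om_ge by simp
  also have "\<dots> = 2 * ln Om" using Om_ge by (simp add: ln_realpow)
  finally have "ln L \<le> 2 * ?l" using l by simp
  moreover have "ln (8::real) \<le> 7" using ln_le_minus_one[of 8] by simp
  moreover have "ln (8 * L\<^sup>2) = ln 8 + 2 * ln L" using L_pos by (simp add: ln_mult ln_realpow)
  ultimately have 2: "ln (8 * L\<^sup>2) \<le> 11 * ?l" using l by linarith
  have "1 \<le> L\<^sup>2" using L_ge by (simp add: one_le_power)
  then have "0 \<le> ln (8 * L\<^sup>2)" by simp
  then have "2 * sqrt (2 * L) * ln (8 * L\<^sup>2) \<le> 3 * Om * (11 * ?l)"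
    using mult_mono[OF 1 2] Om_ge by simp
  moreover have "2 * 1 \<le> Om * ?l" using Om_ge l by (intro mult_mono) auto
  ultimately show ?thesis unfolding K2_def by simp
qed

section \<open>The Moreau gap and the total number of oracle calls\<close>

lemma p_hat_eq: "u \<in> X \<Longrightarrow> p_hat Y \<Phi> h u = ereal (p_max Y \<Phi> u + hr u)"
  unfolding p_hat_def by (simp add: h_eq)

lemma p_hat_outside: "u \<notin> X \<Longrightarrow> p_hat Y \<Phi> h u = \<infinity>"
  unfolding p_hat_def using closed_conv_outside[OF h_conv] by simp

lemma p_hat_inf:
  obtains P where "(INF u. p_hat Y \<Phi> h u) = ereal P" "\<And>u. u \<in> X \<Longrightarrow> P \<le> p_max Y \<Phi> u + hr u"
proof -
  let ?I = "INF u. p_hat Y \<Phi> h u"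
  have "(INF u\<in>X. p_hat Y \<Phi> h u) \<le> ?I"
  proof (rule INF_greatest)
    fix u show "(INF u\<in>X. p_hat Y \<Phi> h u) \<le> p_hat Y \<Phi> h u"
      by (cases "u \<in> X") (auto intro: INF_lower simp: p_hat_outside)
  qed
  then have "?I > - \<infinity>" using bounded_below by auto
  moreover have le: "?I \<le> ereal (p_max Y \<Phi> u + hr u)" if "u \<in> X" for u
    using INF_lower[of u UNIV "p_hat Y \<Phi> h"] p_hat_eq[OF that] by simp
  ultimately obtain P where P: "?I = ereal P" using le[OF x0] by (cases ?I) auto
  show thesis by (rule that[OF P]) (use le P in auto)
qed

text \<open>Besides its finiteness, only the greatest lower bound property of the gap is passed on,
  so that the complexity argument can be carried out in the reals.\<close>

lemma moreau_gap_real: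
  assumes P: "(INF u. p_hat Y \<Phi> h u) = ereal P" "\<And>u. u \<in> X \<Longrightarrow> P \<le> p_max Y \<Phi> u + hr u"
  obtains R where "moreau_gap (1 / (2 * m)) (p_hat Y \<Phi> h) x0 = ereal R" "R \<ge> 0"
    "\<And>c. (\<And>u. u \<in> X \<Longrightarrow> c \<le> (norm (x0 - u))\<^sup>2 / 2 + lam * (p_max Y \<Phi> u + hr u - P)) \<Longrightarrow> c \<le> R"
proof -
  let ?t = "\<lambda>u. ereal ((norm (x0 - u))\<^sup>2 / 2) + ereal lam * (p_hat Y \<Phi> h u - ereal P)"
  let ?r = "\<lambda>u. (norm (x0 - u))\<^sup>2 / 2 + lam * (p_max Y \<Phi> u + hr u - P)"
  have G: "moreau_gap (1 / (2 * m)) (p_hat Y \<Phi> h) x0 = (INF u. ?t u)"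
    unfolding moreau_gap_def P(1) lam_def ..
  have tX: "?t u = ereal (?r u)" if "u \<in> X" for u using p_hat_eq[OF that] by simp
  have tout: "?t u = \<infinity>" if "u \<notin> X" for u using p_hat_outside[OF that] lam_pos by simp
  have ge: "ereal c \<le> (INF u. ?t u)" if "\<And>u. u \<in> X \<Longrightarrow> c \<le> ?r u" for c
  proof (rule INF_greatest)
    fix u show "ereal c \<le> ?t u"
    proof (cases "u \<in> X")
      case True
      show ?thesis unfolding tX[OF True] using that[OF True] by simp
    next
      case False
      show ?thesis unfolding tout[OF False] by simp
    qed
  qed
  have "ereal 0 \<le> (INF u. ?t u)"
    by (rule ge) (use P(2) lam_pos in simp)
  moreover have "(INF u. ?t u) \<le> ereal (?r x0)"
    using INF_lower[of x0 UNIV ?t] tX[OF x0] by simp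
  ultimately obtain R where R: "(INF u. ?t u) = ereal R" "R \<ge> 0" by (cases "INF u. ?t u") auto
  show thesis by (rule that[of R]) (use G R ge in auto)
qed

lemma AIPP_terminates: "\<exists>x u qs. outputs x0 x u qs"
  and AIPP_complexity: "outputs x0 x u qs \<Longrightarrow> \<exists>N. performs_oracle_calls N qs \<and>
    big_O (ereal (real N)) (ereal Om * (ereal (m\<^sup>2 / \<rho>\<^sup>2) * moreau_gap (1 / (2 * m)) (p_hat Y \<Phi> h) x0
       + ereal (m * (diameter Y)\<^sup>2 / (\<xi> * \<rho>\<^sup>2)) + ereal (log1_plus Om)))"
proof -
  obtain P where P: "(INF u. p_hat Y \<Phi> h u) = ereal P" "\<And>u. u \<in> X \<Longrightarrow> P \<le> p_max Y \<Phi> u + hr u"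
    using p_hat_inf by blast
  obtain R where R: "moreau_gap (1 / (2 * m)) (p_hat Y \<Phi> h) x0 = ereal R" "R \<ge> 0"
    "\<And>c. (\<And>u. u \<in> X \<Longrightarrow> c \<le> (norm (x0 - u))\<^sup>2 / 2 + lam * (p_max Y \<Phi> u + hr u - P)) \<Longrightarrow> c \<le> R"
    using moreau_gap_real[OF P] by blast
  define E where "E = (diameter Y)\<^sup>2 / (2 * \<xi>)"
  have p: "f u \<le> p_max Y \<Phi> u" "p_max Y \<Phi> u \<le> f u + E" if "u \<in> X" for u
    using p_max_bounds[of u] that Omega(2) unfolding E_def by auto
  have lb: "P - E \<le> F u" if "u \<in> X" for u
    using P(2)[OF that] p[OF that] unfolding F_def by simp
  have center: "center x0 x0" by (rule center.init)
  show "\<exists>x u qs. outputs x0 x u qs" by (rule outputs_exist[OF lb center])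
  let ?a = "m\<^sup>2 / \<rho>\<^sup>2 * R" and ?b = "m * (diameter Y)\<^sup>2 / (\<xi> * \<rho>\<^sup>2)" and ?l = "log1_plus Om"
  have nonneg: "?a \<ge> 0" "?b \<ge> 0" "?l \<ge> 1"
    using R(2) \<xi> parameters \<rho> unfolding log1_plus_def by auto
  have 1: "Om \<le> Om * ?l" "0 \<le> Om * ?a" "0 \<le> Om * ?b"
    using mult_left_mono[OF nonneg(3), of Om] mult_nonneg_nonneg[OF _ nonneg(1), of Om]
      mult_nonneg_nonneg[OF _ nonneg(2), of Om] Om_ge by linarith+
  assume out: "outputs x0 x u qs"
  \<comment> \<open>The 2 in the bracket includes one extra \<open>K1\<close> for the first run,
    which is counted separately: only the gap after it is controlled by the Moreau gap.\<close>
  then have "\<exists>N. performs_oracle_calls N qs \<and> real N \<le> K1 * (12800 * ?a + 1600 * ?b + 2) + K2"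
  proof (cases rule: outputs.cases)
    case (stop k k' z')
    note hyps = center stop(4,5,6)
    have "performs_oracle_calls (k + k') qs"
      unfolding stop(3) by (rule performs_oracle_calls_append[OF performs_acg_run_queries
          performs_acg_refine_queries[OF ACG2_output(2)[OF hyps]]])
    moreover have "real k \<le> K1" "real k' \<le> K2"
      unfolding K1_def K2_def using ACG1_iterations[OF center stop(4)] ACG2_iterations[OF hyps] by auto
    moreover have "K1 * 1 \<le> K1 * (12800 * ?a + 1600 * ?b + 2)"
      using K1_pos nonneg by (intro mult_left_mono) auto
    ultimately show ?thesis by (intro exI[of _ "k + k'"]) auto
  next
    case (continue k qs')
    note hyps = center continue(2,3)
    let ?z = "yk x0 k"
    obtain N where N: "performs_oracle_calls N qs'" "real N \<le> K1 * ((F ?z - (P - E)) / \<delta> + 1) + K2"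
      using outputs_count[OF lb continue(4) center.step[OF hyps]] by blast
    \<comment> \<open>Halving the first-step inequality matches its quadratic term with the Moreau
      gap; the other half of the value gap at \<open>u\<close> is added for free, since it is
      nonnegative.\<close>
    have "lam * (F ?z - P) / 2 \<le> R"
    proof (rule R(3))
      fix u assume u: "u \<in> X"
      have "lam * F ?z \<le> lam * F u + (norm (x0 - u))\<^sup>2" by (rule ACG1_first_step[OF hyps(1,2) u])
      moreover have "lam * F u \<le> lam * (p_max Y \<Phi> u + hr u)"
        using p[OF u] lam_pos unfolding F_def by simp
      moreover have "lam * P \<le> lam * (p_max Y \<Phi> u + hr u)" using P(2)[OF u] lam_pos by simp
      ultimately show "lam * (F ?z - P) / 2 \<le> (norm (x0 - u))\<^sup>2 / 2 + lam * (p_max Y \<Phi> u + hr u - P)"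
        unfolding right_diff_distrib by argo
    qed
    then have "F ?z - P \<le> 4 * m * R"
      using parameters unfolding lam_def by (simp add: field_simps)
    then have "(F ?z - (P - E)) / \<delta> \<le> (4 * m * R + E) / \<delta>"
      using \<delta>_pos by (intro divide_right_mono) auto
    also have "\<dots> = 12800 * ?a + 1600 * ?b"
      unfolding \<delta>_def E_def lam_def using parameters \<rho> \<xi> by (simp add: field_simps power2_eq_square)
    finally have "K1 * ((F ?z - (P - E)) / \<delta> + 1) \<le> K1 * (12800 * ?a + 1600 * ?b + 1)"
      using K1_pos by (intro mult_left_mono) auto
    moreover have "real k \<le> K1"
      unfolding K1_def by (rule ACG1_iterations[OF hyps(1,2)])
    ultimately have "real (k + N) \<le> K1 * (12800 * ?a + 1600 * ?b + 2) + K2"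
      using N(2) unfolding distrib_left by simp
    then show ?thesis
      using performs_oracle_calls_append[OF performs_acg_run_queries N(1)] unfolding continue(1) by blast
  qed
  then obtain N where N: "performs_oracle_calls N qs" "real N \<le> K1 * (12800 * ?a + 1600 * ?b + 2) + K2"
    by blast
  have "K1 * (12800 * ?a + 1600 * ?b + 2) \<le> 10 * Om * (12800 * ?a + 1600 * ?b + 2)"
    using K1_le nonneg by (intro mult_right_mono) auto
  also have "\<dots> = 128000 * (Om * ?a) + 16000 * (Om * ?b) + 20 * Om" by (simp add: algebra_simps)
  finally have N_le: "real N \<le> 128000 * (Om * ?a) + 16000 * (Om * ?b) + 20 * Om + 34 * (Om * ?l)"
    using N(2) K2_le by linarith
  have arith: "t \<le> 10 ^ 6 * (a + b + d)"
    if "t \<le> 128000 * a + 16000 * b + 20 * c + 34 * d" "c \<le> d" "0 \<le> a" "0 \<le> b" "0 \<le> c" for a b c d t :: real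
    using that by simp
  have "real N \<le> big_O_const * (Om * ?a + Om * ?b + Om * ?l)"
    unfolding big_O_const_def by (rule arith[OF N_le 1]) (use Om_ge in simp)
  also have "\<dots> \<le> big_O_const * max 1 (Om * ?a + Om * ?b + Om * ?l)"
    unfolding big_O_const_def by (intro mult_left_mono) auto
  finally have "ereal (real N) \<le> ereal big_O_const * max 1 (ereal (Om * ?a + Om * ?b + Om * ?l))"
    by (simp add: max_def split: if_splits)
  then show "\<exists>N. performs_oracle_calls N qs \<and>
    big_O (ereal (real N)) (ereal Om * (ereal (m\<^sup>2 / \<rho>\<^sup>2) * moreau_gap (1 / (2 * m)) (p_hat Y \<Phi> h) x0
       + ereal (m * (diameter Y)\<^sup>2 / (\<xi> * \<rho>\<^sup>2)) + ereal (log1_plus Om)))"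
    using N(1) unfolding big_O_def R(1) by (intro exI[of _ N]) (simp add: distrib_left)
qed

end

text \<open>As \<open>outputs\<close> only relates finished runs to their results, existence of a
  finished run is a separate conjunct; the bounds for all outputs are then not vacuous.\<close>

theorem proposition6p3p2:
  fixes X D \<Omega> :: "'a::euclidean_space set" and Y :: "'b::euclidean_space set"
    and \<Phi> :: "'a \<Rightarrow> 'b \<Rightarrow> real" and h :: "'a \<Rightarrow> ereal"
    and m Lx Ly \<xi> \<rho> \<rho>x \<rho>y :: real and x0 :: 'a and y0 :: 'b
  assumes "minmax X Y \<Omega> \<Phi> h m Lx Ly"
    and "\<rho>x > 0" "\<rho>y > 0" "x0 \<in> X" "y0 \<in> Y"
    and "\<xi> > 0" "\<xi> \<ge> diameter Y / \<rho>y" "\<rho> = \<rho>x"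
    and "convex D" "X \<subseteq> D" "D \<subseteq> \<Omega>" "curvature_on D Y \<Phi> m Lx Ly"
    and "aipp_s.acg_points Y \<Phi> h m Lx Ly y0 \<xi> \<rho> x0 \<subseteq> D"
  shows
    "(\<exists>x u qs. aipp_s.outputs Y \<Phi> h m Lx Ly y0 \<xi> \<rho> x0 x u qs) \<and>
     (\<forall>x u qs. aipp_s.outputs Y \<Phi> h m Lx Ly y0 \<xi> \<rho> x0 x u qs \<longrightarrow>
       (\<exists>N. performs_oracle_calls N qs \<and>
          big_O (ereal (real N))
            (ereal (Omega_xi m Lx Ly \<xi>) *
              (ereal (m\<^sup>2 / \<rho>x\<^sup>2) * moreau_gap (1 / (2 * m)) (p_hat Y \<Phi> h) x0 +
               ereal (m * (diameter Y)\<^sup>2 / (\<xi> * \<rho>x\<^sup>2)) +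
               ereal (log1_plus (Omega_xi m Lx Ly \<xi>))))) \<and>
       (let ybar = aipp_s.y_xi Y \<Phi> y0 \<xi> x; vbar = (1 / \<xi>) *\<^sub>R (y0 - ybar) in
          u \<in> (\<lambda>g. grad_x \<Phi> x ybar + g) ` subdiff h x \<and>
          vbar \<in> subdiff (neg_ext Y (\<Phi> x)) ybar \<and>
          norm u \<le> \<rho>x \<and> norm vbar \<le> \<rho>y))"
proof -
  interpret minmax X Y \<Omega> \<Phi> h m Lx Ly by fact
  interpret run: aipp_run X D Y \<Omega> \<Phi> h m Lx Ly y0 \<xi> \<rho> x0
    by unfold_locales (use assms in auto)
  show ?thesis
    unfolding \<open>\<rho> = \<rho>x\<close>[symmetric] Let_def
  proof (intro conjI allI impI)
    show "\<exists>x u qs. run.outputs x0 x u qs" by (rule run.AIPP_terminates)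
    fix x u qs assume out: "run.outputs x0 x u qs"
    show "\<exists>N. performs_oracle_calls N qs \<and>
          big_O (ereal (real N))
            (ereal (Omega_xi m Lx Ly \<xi>) *
              (ereal (m\<^sup>2 / \<rho>\<^sup>2) * moreau_gap (1 / (2 * m)) (p_hat Y \<Phi> h) x0 +
               ereal (m * (diameter Y)\<^sup>2 / (\<xi> * \<rho>\<^sup>2)) +
               ereal (log1_plus (Omega_xi m Lx Ly \<xi>))))"
      by (rule run.AIPP_complexity[OF out])
    note sol = run.outputs_solution[OF out run.center.init]
    then show "u \<in> (\<lambda>g. grad_x \<Phi> x (run.y_xi x) + g) ` subdiff h x" "norm u \<le> \<rho>" by auto
    have "x \<in> \<Omega>" using sol Omega(2) by auto
    then show "(1 / \<xi>) *\<^sub>R (y0 - run.y_xi x) \<in> subdiff (neg_ext Y (\<Phi> x)) (run.y_xi x)"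
      "norm ((1 / \<xi>) *\<^sub>R (y0 - run.y_xi x)) \<le> \<rho>y"
      using run.vbar_subdiff run.norm_vbar assms by auto
  qed
qed

end
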